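(* Let $n\ge2$ be an integer, $p\ge1$ real, let $f:\mathbb{R}^n\to\mathbb{R}$ be a nonzero nonnegative continuous function with compact support, and let $\varepsilon\in\{0,\frac12,1\}$. Then there exists a point $c_{f,p}\in\mathbb{R}^n$ such that $0$ is the Santaló point of $M_{\varepsilon,p}M_{\varepsilon,p}^\circ(f^{c_{f,p}})$. In other words, the point $c_{f,p}$ satisfies $\mathbf{c}\big(M_{\varepsilon,p}^\circ M_{\varepsilon,p}^\circ(f^{c_{f,p}})\big)=0$.
   Context: For $s\in\mathbb{R}^n$, $f^s(x)=f(x-s)$. For $\varepsilon\in[0,1]$, $$\langle y,z\rangle_\varepsilon^p=(1-\varepsilon)\max\{\langle y,z\rangle,0\}^p+\varepsilon\max\{-\langle y,z\rangle,0\}^p .$$ For a nonnegative continuous compactly supported function $f$ on $\mathbb{R}^n$, $M_{\varepsilon,p}f$ is the convex set with support function $h(M_{\varepsilon,p}f,y)=\left(\int_{\mathbb{R}^n}f(z)\langle y,z\rangle_\varepsilon^p\,dz\right)^{1/p}$; for a set $K\subset\mathbb{R}^n$, $M_{\varepsilon,p}K$ is the convex set with support function $h(M_{\varepsilon,p}K,y)=\left(\int_K\langle y,z\rangle_\varepsilon^p\,dz\right)^{1/p}$. The polar of a convex set $K$ is $K^\circ=\{y\in\mathbb{R}^n:\langle y,z\rangle\le1\ \forall z\in K\}$. Write $M_{\varepsilon,p}^\circ f=(M_{\varepsilon,p}f)^\circ$ and $M_{\varepsilon,p}^\circ K=(M_{\varepsilon,p}K)^\circ$; thus $M_{\varepsilon,p}M_{\varepsilon,p}^\circ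 f=M_{\varepsilon,p}\big((M_{\varepsilon,p}f)^\circ\big)$, and $M_{\varepsilon,p}^\circ M_{\varepsilon,p}^\circ f$ is its polar, i.e. the set $\{y:\int_{M_{\varepsilon,p}^\circ f}\langle y,z\rangle_\varepsilon^p\,dz\le1\}$. A convex body is a compact convex set with nonempty interior. The Santaló point of a convex body $K$ is the unique point $s\in K$ for which the volume of $(K-s)^\circ$ is minimal. $\mathbf{c}(K)$ denotes the center of mass of $K$, and $\mathbf{c}(K)=0$ means $\int_K z\,dz=0$. *)

theory Defs
  imports "HOL-Analysis.Analysis"
begin

definition translate :: "('a::real_vector \<Rightarrow> real) \<Rightarrow> 'a \<Rightarrow> 'a \<Rightarrow> real" where
  "translate f s = (\<lambda>x. f (x - s))"

text \<open>The expression \<open>\<langle>y, z\<rangle>\<^sub>\<epsilon>\<^sup>p\<close>; recall that \<open>0 powr p = 0\<close>.\<close>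

definition asym_pow :: "real \<Rightarrow> real \<Rightarrow> 'a::real_inner \<Rightarrow> 'a \<Rightarrow> real" where
  "asym_pow \<epsilon> p y z =
     (1 - \<epsilon>) * (max (y \<bullet> z) 0) powr p + \<epsilon> * (max (- (y \<bullet> z)) 0) powr p"

text \<open>Support functions and the integrals defining the moment bodies take values in the extended
  reals. The integral of \<open>asym_pow\<close> over an unbounded set can be infinite, and then the associated
  closed convex set is unbounded.\<close>

definition support_fun :: "'a::real_inner set \<Rightarrow> 'a \<Rightarrow> ereal" where
  "support_fun K y = (SUP x\<in>K. ereal (x \<bullet> y))"

definition ext_root :: "real \<Rightarrow> ennreal \<Rightarrow> ereal" where
  "ext_root p t = (if t = \<infinity> then \<infinity> else ereal (enn2real t powr (1 / p)))"

text \<open>A support function determines a convex set only up to closure; the closed one is taken.\<close>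

definition convex_set_of_support :: "('a::euclidean_space \<Rightarrow> ereal) \<Rightarrow> 'a set" where
  "convex_set_of_support h =
     (THE K. closed K \<and> convex K \<and> (\<forall>y. support_fun K y = h y))"

definition moment_body_fun :: "real \<Rightarrow> real \<Rightarrow> ('a::euclidean_space \<Rightarrow> real) \<Rightarrow> 'a set" where
  "moment_body_fun \<epsilon> p f =
     convex_set_of_support
       (\<lambda>y. ext_root p (\<integral>\<^sup>+ z. ennreal (f z * asym_pow \<epsilon> p y z) \<partial>lborel))"

definition moment_body_set :: "real \<Rightarrow> real \<Rightarrow> 'a::euclidean_space set \<Rightarrow> 'a set" where
  "moment_body_set \<epsilon> p K =
     convex_set_of_support
       (\<lambda>y. ext_root p (\<integral>\<^sup>+ z\<in>K. ennreal (asym_pow \<epsilon> p y z) \<partial>lborel))"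

definition polar :: "'a::real_inner set \<Rightarrow> 'a set" where
  "polar K = {y. \<forall>z\<in>K. y \<bullet> z \<le> 1}"

definition polar_moment_fun :: "real \<Rightarrow> real \<Rightarrow> ('a::euclidean_space \<Rightarrow> real) \<Rightarrow> 'a set" where
  "polar_moment_fun \<epsilon> p f = polar (moment_body_fun \<epsilon> p f)"

definition polar_moment_set :: "real \<Rightarrow> real \<Rightarrow> 'a::euclidean_space set \<Rightarrow> 'a set" where
  "polar_moment_set \<epsilon> p K = polar (moment_body_set \<epsilon> p K)"

definition convex_body :: "'a::euclidean_space set \<Rightarrow> bool" where
  "convex_body K \<longleftrightarrow> compact K \<and> convex K \<and> interior K \<noteq> {}"

text \<open>\<open>s\<close> is the one and only minimizer over \<open>K\<close>. The volume is an \<open>ennreal\<close>: it is infinite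
  when the point lies on the boundary of \<open>K\<close>.\<close>

definition is_santalo_point :: "'a::euclidean_space set \<Rightarrow> 'a \<Rightarrow> bool" where
  "is_santalo_point K s \<longleftrightarrow>
     convex_body K \<and>
     (\<forall>t. is_arg_min (\<lambda>u. emeasure lborel (polar ((\<lambda>x. x - u) ` K))) (\<lambda>u. u \<in> K) t
            \<longleftrightarrow> t = s)"

definition center_of_mass :: "'a::euclidean_space set \<Rightarrow> 'a" where
  "center_of_mass K = (1 / measure lborel K) *\<^sub>R (LINT z:K|lborel. z)"

end

theory Submission
  imports Defs "HOL-Probability.Distributions"
begin

text \<open>
The essential case is \<open>\<epsilon> = 0\<close>. For \<open>\<epsilon> = 1/2\<close> all bodies are symmetric and \<open>c = 0\<close> works
(\<open>santalo_symmetric\<close>), and for \<open>\<epsilon> = 1\<close> the body \<open>K\<close> below is reflected in the origin while \<open>L\<close> does not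
change (\<open>L_1_eq\<close>), so the point found for \<open>\<epsilon> = 0\<close> works again.

For \<open>c\<close> in the space let \<open>K c\<close> be the set of all \<open>y\<close> for which the integral of \<open>asym_pow 0 p y\<close> against
the translate of \<open>f\<close> by \<open>c\<close> is at most 1, and let \<open>L c\<close> be the set of all \<open>w\<close> for which the integral of
\<open>asym_pow 0 p w\<close> over \<open>K c\<close> is at most 1. Let \<open>V c\<close> be the integral of \<open>z\<close> over \<open>L c\<close>. A zero of \<open>V\<close> is
sought. The set \<open>K c\<close> is closed and convex; it may be unbounded, and its recession cone \<open>N c\<close>
consists of the \<open>u\<close> with \<open>u \<bullet> (z + c) \<le> 0\<close> for all \<open>z\<close> with \<open>f z \<noteq> 0\<close>. The integrals over \<open>K c\<close> are
infinite in every direction \<open>w\<close> with \<open>w \<bullet> u > 0\<close> for some \<open>u\<close> in \<open>N c\<close>. So \<open>L c\<close> lies in the polar cone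
of \<open>N c\<close> (\<open>L_subset_halfspace\<close>); it nevertheless has nonempty interior (\<open>interior_L_nonempty\<close>). The map
\<open>V\<close> is continuous on a ball containing the support of \<open>f\<close> (\<open>continuous_on_centroid\<close>), and Brouwer's
theorem gives a point \<open>c\<close> of the ball with \<open>V c \<bullet> (x - c) \<ge> 0\<close> for all \<open>x\<close> of the ball. Taking
\<open>x = - z\<close> shows that \<open>V c\<close> belongs to \<open>N c\<close>, whence \<open>V c \<bullet> V c \<le> 0\<close>. Thus \<open>V c = 0\<close>, and the nonempty
interior of \<open>L c\<close> then forces \<open>N c = {0}\<close>, so that \<open>K c\<close> is compact (\<open>exists_centred\<close>).

If \<open>K c\<close> is compact, the moment body of \<open>K c\<close> is the polar of \<open>L c\<close>, and \<open>L c\<close> is the polar of the moment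
body (\<open>polar_polar_moment_ball\<close>). That the centroid of \<open>L c\<close> is zero makes the origin the Santalo point
(\<open>centred_moment_ball_santalo\<close>): with \<open>h\<close> the gauge of \<open>L c\<close>, the polar of the moment body translated by
\<open>- u\<close> has volume proportional to the integral of \<open>exp (- h y + u \<bullet> y)\<close>, and \<open>exp x \<ge> 1 + x\<close>
(\<open>emeasure_gauge_ball_less_tilted\<close>).
\<close>

section \<open>Moments of a weight\<close>

text \<open>Moment bodies of functions and of sets are treated together as moments of a weight \<open>m\<close>: the weight
is a translate of \<open>f\<close> for the former and an indicator for the latter. The \<open>p\<close>-th power of the support
function is \<open>moment_int\<close>, and the polar of the moment body is its unit sublevel set \<open>moment_ball\<close>. The
latter makes sense, and is used, even for weights whose moments are infinite in some directions.\<close>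

definition moment_int :: "real \<Rightarrow> real \<Rightarrow> ('a::euclidean_space \<Rightarrow> real) \<Rightarrow> 'a \<Rightarrow> ennreal" where
  "moment_int \<epsilon> p m w = (\<integral>\<^sup>+ z. ennreal (m z * asym_pow \<epsilon> p w z) \<partial>lborel)"

definition moment_ball :: "real \<Rightarrow> real \<Rightarrow> ('a::euclidean_space \<Rightarrow> real) \<Rightarrow> 'a set" where
  "moment_ball \<epsilon> p m = {w. moment_int \<epsilon> p m w \<le> 1}"

text \<open>The positive part is convex and \<open>t \<mapsto> t powr p\<close> is convex and increasing on the nonnegative reals; the
endpoint \<open>0\<close> is treated separately, through \<open>s powr p \<le> s\<close> for \<open>s\<close> in the unit interval.\<close>

lemma pos_part_powr_convex:
  fixes p s x y :: real
  assumes "p \<ge> 1" "0 \<le> s" "s \<le> 1"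
  shows "max ((1 - s) * x + s * y) 0 powr p \<le> (1 - s) * max x 0 powr p + s * max y 0 powr p"
proof -
  have small: "(t * a) powr p \<le> t * a powr p" if "0 \<le> t" "t \<le> 1" "0 \<le> a" for t a :: real
  proof -
    have "t powr p \<le> t"
    proof (cases "t = 0")
      case False
      then have "t powr p \<le> t powr 1" using that assms by (intro powr_mono') auto
      then show ?thesis using that False by simp
    qed auto
    then show ?thesis using that by (simp add: powr_mult mult_right_mono)
  qed
  define a b where "a = max x 0" and "b = max y 0"
  have ab: "a \<ge> 0" "b \<ge> 0" by (auto simp: a_def b_def)
  have "(1 - s) * x \<le> (1 - s) * a" "s * y \<le> s * b"
    using assms by (auto simp: a_def b_def intro!: mult_left_mono)
  then have "max ((1 - s) * x + s * y) 0 \<le> (1 - s) * a + s * b"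
    using assms ab by auto
  then have "max ((1 - s) * x + s * y) 0 powr p \<le> ((1 - s) * a + s * b) powr p"
    using assms by (intro powr_mono2) auto
  also have "\<dots> \<le> (1 - s) * a powr p + s * b powr p"
  proof (cases "a = 0 \<or> b = 0")
    case True
    then show ?thesis using small[of s b] small[of "1 - s" a] ab assms by auto
  next
    case False
    then show ?thesis
      using convex_onD[OF powr_convex[OF assms(1)], of s a b] assms ab by auto
  qed
  finally show ?thesis by (simp add: a_def b_def)
qed

context
  fixes \<epsilon> p :: real
  assumes eps: "0 \<le> \<epsilon>" "\<epsilon> \<le> 1" and p: "1 \<le> p"
begin

lemma asym_pow_nonneg: "0 \<le> asym_pow \<epsilon> p y z"
  using eps by (simp add: asym_pow_def)

lemma asym_pow_scale: "0 \<le> t \<Longrightarrow> asym_pow \<epsilon> p (t *\<^sub>R y) z = t powr p * asym_pow \<epsilon> p y z"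
proof -
  assume t: "0 \<le> t"
  have "max (t * x) 0 = t * max x 0" for x :: real
    using t by (auto simp: max_def mult_le_0_iff zero_le_mult_iff)
  from this[of "y \<bullet> z"] this[of "- (y \<bullet> z)"] show ?thesis
    using t by (simp add: asym_pow_def powr_mult algebra_simps)
qed

lemma asym_pow_le: "asym_pow \<epsilon> p y z \<le> (norm y * norm z) powr p"
proof -
  have 1: "max (y \<bullet> z) 0 powr p \<le> (norm y * norm z) powr p"
    using p norm_cauchy_schwarz[of y z] by (intro powr_mono2) auto
  have 2: "max (- (y \<bullet> z)) 0 powr p \<le> (norm y * norm z) powr p"
    using p Cauchy_Schwarz_ineq2[of y z] by (intro powr_mono2) auto
  have "asym_pow \<epsilon> p y z \<le> (1 - \<epsilon>) * (norm y * norm z) powr p + \<epsilon> * (norm y * norm z) powr p"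
    unfolding asym_pow_def using 1 2 eps by (intro add_mono mult_left_mono) auto
  then show ?thesis by (simp add: algebra_simps)
qed

lemma asym_pow_convex:
  assumes "0 \<le> s" "s \<le> 1"
  shows "asym_pow \<epsilon> p ((1 - s) *\<^sub>R a + s *\<^sub>R b) z
    \<le> (1 - s) * asym_pow \<epsilon> p a z + s * asym_pow \<epsilon> p b z"
proof -
  have "asym_pow \<epsilon> p ((1 - s) *\<^sub>R a + s *\<^sub>R b) z \<le>
     (1 - \<epsilon>) * ((1 - s) * max (a \<bullet> z) 0 powr p + s * max (b \<bullet> z) 0 powr p)
     + \<epsilon> * ((1 - s) * max (- (a \<bullet> z)) 0 powr p + s * max (- (b \<bullet> z)) 0 powr p)"
    unfolding asym_pow_def
    using pos_part_powr_convex[OF p assms, of "a \<bullet> z" "b \<bullet> z"]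
      pos_part_powr_convex[OF p assms, of "- (a \<bullet> z)" "- (b \<bullet> z)"] eps
    by (intro add_mono mult_left_mono) (auto simp: inner_add_left)
  then show ?thesis by (simp add: asym_pow_def algebra_simps)
qed

lemma continuous_on_asym_pow:
  "continuous_on S (\<lambda>x. asym_pow \<epsilon> p (u x) (v x))"
  if "continuous_on S u" "continuous_on S v"
  unfolding asym_pow_def using p
  by (intro continuous_intros that continuous_on_powr') auto

lemma asym_pow_tendsto:
  "(\<lambda>j. asym_pow \<epsilon> p (u j) z) \<longlonglongrightarrow> asym_pow \<epsilon> p w z" if "u \<longlonglongrightarrow> w"
proof -
  have "isCont (\<lambda>x. asym_pow \<epsilon> p x z) w"
    using continuous_on_asym_pow[of UNIV "\<lambda>x. x" "\<lambda>x. z"]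
    by (simp add: continuous_on_eq_continuous_at)
  from isCont_tendsto_compose[OF this that] show ?thesis .
qed

lemma asym_pow_measurable [measurable]:
  "(\<lambda>z. asym_pow \<epsilon> p w z) \<in> borel_measurable borel"
  by (intro borel_measurable_continuous_onI continuous_on_asym_pow continuous_intros)

lemma asym_pow_measurable_pair [measurable]:
  "(\<lambda>(w, z). asym_pow \<epsilon> p w (z::'a::euclidean_space)) \<in> borel_measurable (borel \<Otimes>\<^sub>M borel)"
  unfolding borel_prod split_beta
  by (intro borel_measurable_continuous_onI continuous_on_asym_pow continuous_intros)

lemma moment_int_scale:
  assumes [measurable]: "m \<in> borel_measurable borel" and "\<And>z. 0 \<le> m z" and "0 \<le> t"
  shows "moment_int \<epsilon> p m (t *\<^sub>R w) = ennreal (t powr p) * moment_int \<epsilon> p m w"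
proof -
  have "moment_int \<epsilon> p m (t *\<^sub>R w)
      = (\<integral>\<^sup>+ z. ennreal (t powr p) * ennreal (m z * asym_pow \<epsilon> p w z) \<partial>lborel)"
    unfolding moment_int_def asym_pow_scale[OF assms(3)]
    by (intro nn_integral_cong) (simp add: ennreal_mult'[symmetric] mult.left_commute)
  also have "\<dots> = ennreal (t powr p) * moment_int \<epsilon> p m w"
    unfolding moment_int_def by (rule nn_integral_cmult) simp
  finally show ?thesis .
qed

lemma moment_int_0: "moment_int \<epsilon> p m 0 = 0"
  using p by (simp add: moment_int_def asym_pow_def)

text \<open>Lower semicontinuity in the weight and in the direction at once. This is the only continuity that
survives when the weights have unbounded supports, where mass may escape to infinity.\<close>

lemma moment_int_fatou:
  assumes [measurable]: "\<And>j. m j \<in> borel_measurable borel" "m' \<in> borel_measurable borel"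
    and "\<And>j z. 0 \<le> m j z"
    and lim: "AE z in lborel. (\<lambda>j. m j z) \<longlonglongrightarrow> m' z" and u: "u \<longlonglongrightarrow> w"
  shows "moment_int \<epsilon> p m' w \<le> liminf (\<lambda>j. moment_int \<epsilon> p (m j) (u j))"
proof -
  have "AE z in lborel. ennreal (m' z * asym_pow \<epsilon> p w z)
      = liminf (\<lambda>j. ennreal (m j z * asym_pow \<epsilon> p (u j) z))"
    using lim
  proof eventually_elim
    case (elim z)
    have "(\<lambda>j. ennreal (m j z * asym_pow \<epsilon> p (u j) z)) \<longlonglongrightarrow> ennreal (m' z * asym_pow \<epsilon> p w z)"
      by (intro tendsto_ennrealI tendsto_mult elim asym_pow_tendsto u)
    then show ?case by (metis lim_imp_Liminf trivial_limit_sequentially)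
  qed
  then have "moment_int \<epsilon> p m' w
      = (\<integral>\<^sup>+ z. liminf (\<lambda>j. ennreal (m j z * asym_pow \<epsilon> p (u j) z)) \<partial>lborel)"
    unfolding moment_int_def by (rule nn_integral_cong_AE)
  also have "\<dots> \<le> liminf (\<lambda>j. moment_int \<epsilon> p (m j) (u j))"
    unfolding moment_int_def by (intro nn_integral_liminf) simp
  finally show ?thesis .
qed

lemma moment_int_bounded_support_finite:
  fixes m :: "'a::euclidean_space \<Rightarrow> real"
  assumes "\<And>z. m z \<le> B * indicator (cball 0 R) z" "0 \<le> B"
  shows "moment_int \<epsilon> p m w \<le> ennreal (B * (norm w * R) powr p) * emeasure lborel (cball 0 R :: 'a set)"
proof -
  have "m z * asym_pow \<epsilon> p w z \<le> B * (norm w * R) powr p * indicator (cball 0 R) z" for z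
  proof (cases "z \<in> cball 0 R")
    case True
    have "asym_pow \<epsilon> p w z \<le> (norm w * R) powr p"
      using p True by (intro order_trans[OF asym_pow_le] powr_mono2 mult_left_mono) auto
    moreover have "m z \<le> B" using assms(1)[of z] True by simp
    ultimately have "m z * asym_pow \<epsilon> p w z \<le> B * (norm w * R) powr p"
      using asym_pow_nonneg assms(2) by (intro mult_mono) auto
    then show ?thesis using True by simp
  next
    case False
    then have "m z \<le> 0" using assms(1)[of z] by simp
    then have "m z * asym_pow \<epsilon> p w z \<le> 0" using asym_pow_nonneg by (rule mult_nonpos_nonneg)
    then show ?thesis using False by simp
  qed
  then have "moment_int \<epsilon> p m w \<le> (\<integral>\<^sup>+ (z::'a). ennreal (B * (norm w * R) powr p) * indicator (cball 0 R) z \<partial>lborel)"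
    unfolding moment_int_def
    by (intro nn_integral_mono) (auto simp: ennreal_indicator[symmetric] ennreal_mult''[symmetric] intro!: ennreal_leI)
  also have "\<dots> = ennreal (B * (norm w * R) powr p) * emeasure lborel (cball 0 R :: 'a set)"
    by (rule nn_integral_cmult_indicator) simp
  finally show ?thesis .
qed

lemma moment_int_finite:
  fixes m :: "'a::euclidean_space \<Rightarrow> real"
  assumes "\<And>z. m z \<le> B * indicator (cball 0 R) z" "0 \<le> B"
  shows "moment_int \<epsilon> p m w < \<infinity>"
proof -
  have "emeasure lborel (cball 0 R :: 'a set) < \<infinity>"
    using emeasure_lborel_cball_finite by auto
  then show ?thesis
    using moment_int_bounded_support_finite[OF assms, of w] 
    by (metis ennreal_mult_less_top ennreal_less_top infinity_ennreal_def order_le_less_trans)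
qed

text \<open>With a common bound on the weights and on their supports, dominated convergence gives full continuity.\<close>

lemma moment_int_tendsto:
  fixes m :: "nat \<Rightarrow> 'a::euclidean_space \<Rightarrow> real"
  assumes [measurable]: "\<And>j. m j \<in> borel_measurable borel" "m' \<in> borel_measurable borel"
    and bound: "\<And>j z. 0 \<le> m j z" "\<And>j z. m j z \<le> B * indicator (cball 0 R) z" "0 \<le> B"
    and lim: "AE z in lborel. (\<lambda>j. m j z) \<longlonglongrightarrow> m' z" and u: "u \<longlonglongrightarrow> w"
  shows "(\<lambda>j. moment_int \<epsilon> p (m j) (u j)) \<longlonglongrightarrow> moment_int \<epsilon> p m' w"
proof -
  obtain W where W: "\<And>j. norm (u j) \<le> W"
    using convergent_imp_Bseq[OF convergentI[OF u]] by (auto simp: Bseq_def)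
  define C where "C = (W * R) powr p"
  show ?thesis
    unfolding moment_int_def
  proof (rule nn_integral_dominated_convergence[where w = "\<lambda>z. ennreal (B * C) * indicator (cball 0 R) z"])
    show "AE z in lborel. ennreal (m j z * asym_pow \<epsilon> p (u j) z) \<le> ennreal (B * C) * indicator (cball 0 R) z" for j
    proof (intro AE_I2)
      fix z
      show "ennreal (m j z * asym_pow \<epsilon> p (u j) z) \<le> ennreal (B * C) * indicator (cball 0 R) z"
      proof (cases "z \<in> cball 0 R")
        case True
        have "norm (u j) * norm z \<le> W * R"
          using True W[of j] by (intro mult_mono) (auto intro: order_trans[OF norm_ge_zero])
        then have "asym_pow \<epsilon> p (u j) z \<le> C"
          unfolding C_def using p by (intro order_trans[OF asym_pow_le] powr_mono2) auto
        then show ?thesis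
          using True bound(1,3) bound(2)[of j z] asym_pow_nonneg by (auto intro!: ennreal_leI mult_mono)
      next
        case False
        then have "m j z = 0" using bound(1)[of j z] bound(2)[of j z] by simp
        then show ?thesis by simp
      qed
    qed
    show "(\<integral>\<^sup>+ (z::'a). ennreal (B * C) * indicator (cball 0 R) z \<partial>lborel) < \<infinity>"
      using emeasure_lborel_cball_finite[of "0::'a" R]
      by (subst nn_integral_cmult_indicator) (auto intro!: ennreal_mult_less_top[THEN iffD2] simp: less_top)
    show "AE z in lborel. (\<lambda>j. ennreal (m j z * asym_pow \<epsilon> p (u j) z)) \<longlonglongrightarrow> ennreal (m' z * asym_pow \<epsilon> p w z)"
      using lim by eventually_elim (intro tendsto_ennrealI tendsto_mult asym_pow_tendsto u)
    show "(\<lambda>z. ennreal (B * C) * indicator (cball 0 R) z) \<in> borel_measurable lborel"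
      by (intro borel_measurable_times_ennreal borel_measurable_indicator borel_measurable_const) simp
  qed simp_all
qed

text \<open>The integrand is convex in the direction for each \<open>z\<close>, so the moment itself is convex, and not only
its \<open>p\<close>-th root.\<close>

lemma convex_moment_ball:
  assumes [measurable]: "m \<in> borel_measurable borel" and m: "\<And>z. 0 \<le> m z"
  shows "convex (moment_ball \<epsilon> p m)"
  unfolding convex_alt
proof (intro ballI allI impI)
  fix a b s assume a: "a \<in> moment_ball \<epsilon> p m" and b: "b \<in> moment_ball \<epsilon> p m" and s: "0 \<le> s \<and> s \<le> (1::real)"
  have "moment_int \<epsilon> p m ((1 - s) *\<^sub>R a + s *\<^sub>R b)
     \<le> (\<integral>\<^sup>+ z. ennreal (1 - s) * ennreal (m z * asym_pow \<epsilon> p a z) + ennreal s * ennreal (m z * asym_pow \<epsilon> p b z) \<partial>lborel)"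
    unfolding moment_int_def
  proof (intro nn_integral_mono)
    fix z
    have "m z * asym_pow \<epsilon> p ((1 - s) *\<^sub>R a + s *\<^sub>R b) z \<le> m z * ((1 - s) * asym_pow \<epsilon> p a z + s * asym_pow \<epsilon> p b z)"
      using s m by (intro mult_left_mono asym_pow_convex) auto
    also have "\<dots> = (1 - s) * (m z * asym_pow \<epsilon> p a z) + s * (m z * asym_pow \<epsilon> p b z)"
      by (simp add: algebra_simps)
    finally have "ennreal (m z * asym_pow \<epsilon> p ((1 - s) *\<^sub>R a + s *\<^sub>R b) z)
      \<le> ennreal ((1 - s) * (m z * asym_pow \<epsilon> p a z) + s * (m z * asym_pow \<epsilon> p b z))"
      by (rule ennreal_leI)
    also have "\<dots> = ennreal ((1 - s) * (m z * asym_pow \<epsilon> p a z)) + ennreal (s * (m z * asym_pow \<epsilon> p b z))"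
      using s by (intro ennreal_plus mult_nonneg_nonneg m asym_pow_nonneg) auto
    also have "\<dots> = ennreal (1 - s) * ennreal (m z * asym_pow \<epsilon> p a z) + ennreal s * ennreal (m z * asym_pow \<epsilon> p b z)"
      using s by (simp add: ennreal_mult'[symmetric])
    finally show "ennreal (m z * asym_pow \<epsilon> p ((1 - s) *\<^sub>R a + s *\<^sub>R b) z)
      \<le> ennreal (1 - s) * ennreal (m z * asym_pow \<epsilon> p a z) + ennreal s * ennreal (m z * asym_pow \<epsilon> p b z)" .
  qed
  also have "\<dots> = ennreal (1 - s) * moment_int \<epsilon> p m a + ennreal s * moment_int \<epsilon> p m b"
    unfolding moment_int_def by (subst nn_integral_add) (auto simp: nn_integral_cmult)
  also have "\<dots> \<le> ennreal (1 - s) * 1 + ennreal s * 1"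
    using a b by (intro add_mono mult_left_mono) (auto simp: moment_ball_def)
  also have "\<dots> = 1" using s by (simp add: ennreal_plus[symmetric] del: ennreal_plus)
  finally show "(1 - s) *\<^sub>R a + s *\<^sub>R b \<in> moment_ball \<epsilon> p m" by (simp add: moment_ball_def)
qed

lemma closed_moment_ball:
  assumes [measurable]: "m \<in> borel_measurable borel" and m: "\<And>z. 0 \<le> m z"
  shows "closed (moment_ball \<epsilon> p m)"
  unfolding closed_sequential_limits
proof (intro allI impI, elim conjE)
  fix u w assume u: "\<forall>j. u j \<in> moment_ball \<epsilon> p m" "u \<longlonglongrightarrow> w"
  have "moment_int \<epsilon> p m w \<le> liminf (\<lambda>j. moment_int \<epsilon> p m (u j))"
    using m u by (intro moment_int_fatou) auto
  also have "\<dots> \<le> 1"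
    using u by (intro Liminf_le) (auto simp: moment_ball_def)
  finally show "w \<in> moment_ball \<epsilon> p m" by (simp add: moment_ball_def)
qed

lemma zero_in_moment_ball: "0 \<in> moment_ball \<epsilon> p m"
  by (simp add: moment_ball_def moment_int_0)

text \<open>By homogeneity: a slightly larger multiple of an interior point still lies in the ball.\<close>

lemma moment_int_less_1_if_interior:
  assumes [measurable]: "m \<in> borel_measurable borel" and m: "\<And>z. 0 \<le> m z"
    and w: "w \<in> interior (moment_ball \<epsilon> p m)"
  shows "moment_int \<epsilon> p m w < 1"
proof -
  obtain e where e: "e > 0" "ball w e \<subseteq> moment_ball \<epsilon> p m"
    using w by (auto simp: mem_interior)
  define d where "d = e / (2 * (norm w + 1))"
  have d: "d > 0" using e by (auto simp: d_def intro!: divide_pos_pos add_nonneg_pos)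
  have "d * norm w < e"
  proof -
    have "d * norm w \<le> d * (norm w + 1)" using d by simp
    also have "\<dots> = e / 2"
      using norm_ge_zero[of w] by (simp add: d_def field_simps add_nonneg_pos less_imp_neq[symmetric] del: norm_ge_zero)
    finally show ?thesis using e by simp
  qed
  then have "(1 + d) *\<^sub>R w \<in> ball w e" using d by (simp add: dist_norm algebra_simps)
  then have "ennreal ((1 + d) powr p) * moment_int \<epsilon> p m w \<le> 1"
    using e d moment_int_scale[of m "1 + d" w] m by (auto simp: moment_ball_def)
  moreover have "(1 + d) powr p > 1" using d p by simp
  ultimately show ?thesis
  proof (cases "moment_int \<epsilon> p m w")
    case (real r)
    with \<open>ennreal ((1 + d) powr p) * moment_int \<epsilon> p m w \<le> 1\<close> have le: "(1 + d) powr p * r \<le> 1"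
      by (simp add: ennreal_mult'[symmetric])
    have "r < 1"
    proof (rule ccontr)
      assume "\<not> r < 1"
      then have "1 * 1 < (1 + d) powr p * r"
        using \<open>(1 + d) powr p > 1\<close> by (intro mult_less_le_imp_less) auto
      with le show False by simp
    qed
    with real show ?thesis by (simp add: ennreal_less_one_iff)
  next
    case top
    with \<open>(1 + d) powr p > 1\<close> \<open>ennreal ((1 + d) powr p) * moment_int \<epsilon> p m w \<le> 1\<close>
    show ?thesis using d by (auto simp: ennreal_mult_top top_unique split: if_splits)
  qed
qed

end

section \<open>Convex sets determined by a gauge\<close>

lemma support_fun_le_iff: "support_fun K y \<le> ereal c \<longleftrightarrow> (\<forall>x\<in>K. x \<bullet> y \<le> c)"
  by (simp add: support_fun_def SUP_le_iff)

lemma closed_polar: "closed (polar K)"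
proof -
  have *: "polar K = (\<Inter>z\<in>K. {y. z \<bullet> y \<le> 1})" unfolding polar_def by (auto simp: inner_commute)
  show ?thesis unfolding * by (intro closed_INT ballI closed_halfspace_le)
qed

lemma convex_polar: "convex (polar K)"
proof -
  have *: "polar K = (\<Inter>z\<in>K. {y. z \<bullet> y \<le> 1})" unfolding polar_def by (auto simp: inner_commute)
  show ?thesis unfolding * by (intro convex_INT convex_halfspace_le)
qed

text \<open>A nonnegative, positively homogeneous function \<open>h\<close> whose unit sublevel set is closed and convex is the
support function of the polar of that sublevel set, and the sublevel set is recovered as the bipolar.
For moments it is the sublevel set whose convexity is at hand.\<close>

context
  fixes h :: "'a::euclidean_space \<Rightarrow> real"
  assumes h_nonneg: "\<And>y. 0 \<le> h y"
    and h_scale: "\<And>t y. 0 < t \<Longrightarrow> h (t *\<^sub>R y) = t * h y"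
    and h_0: "h 0 = 0"
    and h_closed: "closed {y. h y \<le> 1}" and h_convex: "convex {y. h y \<le> 1}"
begin

lemma polar_gauge_ball: "polar {y. h y \<le> 1} = {x. \<forall>y. x \<bullet> y \<le> h y}"
proof (intro equalityI subsetI)
  fix x assume x: "x \<in> polar {y. h y \<le> 1}"
  \<comment> \<open>Scaling by \<open>h y + e\<close> instead of \<open>h y\<close> covers the directions with \<open>h y = 0\<close>.\<close>
  have "x \<bullet> y \<le> h y + e" if "e > 0" for y e
  proof -
    define s where "s = h y + e"
    have s: "s > 0" using h_nonneg[of y] that by (simp add: s_def add_nonneg_pos)
    have "h ((1 / s) *\<^sub>R y) \<le> 1"
      using s that by (subst h_scale) (auto simp: s_def)
    then have "x \<bullet> ((1 / s) *\<^sub>R y) \<le> 1" using x by (auto simp: polar_def)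
    then show ?thesis using s by (simp add: s_def divide_simps)
  qed
  then show "x \<in> {x. \<forall>y. x \<bullet> y \<le> h y}" by (simp add: field_le_epsilon)
next
  fix x assume x: "x \<in> {x. \<forall>y. x \<bullet> y \<le> h y}"
  have "x \<bullet> y \<le> 1" if "h y \<le> 1" for y
    using x that order_trans[of "x \<bullet> y" "h y" 1] by simp
  then show "x \<in> polar {y. h y \<le> 1}" by (simp add: polar_def)
qed

text \<open>If the supremum were at most \<open>c < t < h y\<close>, then \<open>y / t\<close> would lie outside the sublevel set; a
separating functional, normalised on the sublevel set, belongs to the polar and exceeds \<open>c\<close> at \<open>y\<close>.\<close>

lemma support_fun_polar_gauge_ball: "support_fun (polar {y. h y \<le> 1}) y = ereal (h y)"
proof (rule antisym)
  show "support_fun (polar {y. h y \<le> 1}) y \<le> ereal (h y)"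
    by (auto simp: support_fun_le_iff polar_gauge_ball)
  show "ereal (h y) \<le> support_fun (polar {y. h y \<le> 1}) y"
  proof (rule ereal_le_real)
    fix c assume "support_fun (polar {y. h y \<le> 1}) y \<le> ereal c"
    then have c: "\<And>x. x \<in> polar {y. h y \<le> 1} \<Longrightarrow> x \<bullet> y \<le> c" by (simp add: support_fun_le_iff)
    have "0 \<in> polar {y. h y \<le> 1}" by (simp add: polar_def)
    from c[OF this] have c0: "0 \<le> c" by simp
    have "h y \<le> c"
    proof (rule ccontr)
      assume "\<not> h y \<le> c"
      define t where "t = (h y + c) / 2"
      have t: "c < t" "t < h y" "t > 0" using \<open>\<not> h y \<le> c\<close> c0 by (auto simp: t_def)
      have "h ((1 / t) *\<^sub>R y) > 1" using t by (subst h_scale) auto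
      then have "(1 / t) *\<^sub>R y \<notin> {y. h y \<le> 1}" by simp
      from separating_hyperplane_closed_point[OF h_convex h_closed this]
      obtain a b where ab: "a \<bullet> ((1 / t) *\<^sub>R y) < b" "\<And>x. h x \<le> 1 \<Longrightarrow> b < a \<bullet> x" by auto
      have b: "b < 0" using ab(2)[of 0] h_0 by simp
      have "(1 / b) *\<^sub>R a \<in> polar {y. h y \<le> 1}"
        using ab(2) b by (auto simp: polar_def divide_simps intro: less_imp_le)
      from c[OF this] have "(1 / b) * (a \<bullet> y) \<le> c" by simp
      moreover have "(1 / b) * (a \<bullet> y) > t" using ab(1) b t by (simp add: divide_simps) (simp add: mult.commute)
      ultimately show False using t by simp
    qed
    then show "ereal (h y) \<le> ereal c" by simp
  qed
qed

text \<open>Uniqueness in the description of a closed convex set by its support function: such a set is the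
intersection of its supporting halfspaces.\<close>

lemma convex_set_of_support_gauge: "convex_set_of_support (\<lambda>y. ereal (h y)) = polar {y. h y \<le> 1}"
  unfolding convex_set_of_support_def
proof (rule the_equality)
  show "closed (polar {y. h y \<le> 1}) \<and> convex (polar {y. h y \<le> 1})
      \<and> (\<forall>y. support_fun (polar {y. h y \<le> 1}) y = ereal (h y))"
    by (simp add: closed_polar convex_polar support_fun_polar_gauge_ball)
  fix K assume K: "closed K \<and> convex K \<and> (\<forall>y. support_fun K y = ereal (h y))"
  have "K = {x. \<forall>y. x \<bullet> y \<le> h y}"
  proof (intro equalityI subsetI)
    fix x assume "x \<in> K"
    moreover have "support_fun K y \<le> ereal (h y)" for y using K by simp
    ultimately show "x \<in> {x. \<forall>y. x \<bullet> y \<le> h y}" by (auto simp: support_fun_le_iff)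
  next
    fix x assume x: "x \<in> {x. \<forall>y. x \<bullet> y \<le> h y}"
    show "x \<in> K"
    proof (rule ccontr)
      assume "x \<notin> K"
      from separating_hyperplane_closed_point[OF _ _ this] K
      obtain a b where ab: "a \<bullet> x < b" "\<And>k. k \<in> K \<Longrightarrow> b < a \<bullet> k" by blast
      have "support_fun K (- a) \<le> ereal (- b)"
        using ab(2) by (auto simp: support_fun_le_iff inner_commute intro: less_imp_le)
      then have "h (- a) \<le> - b" using K by simp
      moreover have "x \<bullet> (- a) \<le> h (- a)" using x by blast
      ultimately show False using ab(1) by (simp add: inner_commute)
    qed
  qed
  then show "K = polar {y. h y \<le> 1}" by (simp add: polar_gauge_ball)
qed

text \<open>Translating a body by \<open>- u\<close> subtracts \<open>u \<bullet> y\<close> from its support function. The Santalo functional of the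
polar of \<open>{h \<le> 1}\<close> is therefore the volume of a sublevel set of a tilted gauge.\<close>

lemma polar_translate_polar_gauge_ball:
  "polar ((\<lambda>x. x - u) ` polar {y. h y \<le> 1}) = {y. h y - u \<bullet> y \<le> 1}"
proof -
  have "y \<bullet> (x - u) = x \<bullet> y - u \<bullet> y" for x y :: 'a
    by (simp add: inner_diff_right inner_commute)
  then have "y \<in> polar ((\<lambda>x. x - u) ` polar {y. h y \<le> 1})
      \<longleftrightarrow> (\<forall>x\<in>polar {y. h y \<le> 1}. x \<bullet> y \<le> 1 + u \<bullet> y)" for y
    unfolding polar_def[of "_ ` _"] by (simp add: diff_le_eq)
  then have "y \<in> polar ((\<lambda>x. x - u) ` polar {y. h y \<le> 1}) \<longleftrightarrow> h y \<le> 1 + u \<bullet> y" for y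
    unfolding support_fun_le_iff[symmetric] support_fun_polar_gauge_ball by simp
  then show ?thesis by (intro set_eqI) (simp add: diff_le_eq)
qed

lemma polar_polar_gauge_ball: "polar (polar {y. h y \<le> 1}) = {y. h y \<le> 1}"
  using polar_translate_polar_gauge_ball[of 0] by (simp only: diff_zero image_ident inner_zero_left)

end

definition moment_gauge :: "real \<Rightarrow> real \<Rightarrow> ('a::euclidean_space \<Rightarrow> real) \<Rightarrow> 'a \<Rightarrow> real" where
  "moment_gauge \<epsilon> p m w = enn2real (moment_int \<epsilon> p m w) powr (1 / p)"

context
  fixes \<epsilon> p :: real and m :: "'a::euclidean_space \<Rightarrow> real"
  assumes eps: "0 \<le> \<epsilon>" "\<epsilon> \<le> 1" and p: "1 \<le> p"
    and m [measurable]: "m \<in> borel_measurable borel" and m_nonneg: "\<And>z. 0 \<le> m z"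
    and fin: "\<And>w. moment_int \<epsilon> p m w < \<infinity>"
begin

lemma moment_gauge_ball: "{w. moment_gauge \<epsilon> p m w \<le> 1} = moment_ball \<epsilon> p m"
proof -
  have "moment_gauge \<epsilon> p m w \<le> 1 \<longleftrightarrow> moment_int \<epsilon> p m w \<le> 1" for w
  proof -
    obtain r where r: "moment_int \<epsilon> p m w = ennreal r" "0 \<le> r"
      using fin[of w] by (cases "moment_int \<epsilon> p m w") auto
    have "r powr (1 / p) \<le> 1 \<longleftrightarrow> r \<le> 1"
    proof
      show "r powr (1 / p) \<le> 1" if "r \<le> 1"
        using powr_mono2[of "1/p" r 1] p r that by simp
      show "r \<le> 1" if "r powr (1 / p) \<le> 1"
      proof (rule ccontr)
        assume "\<not> r \<le> 1"
        then have "1 powr (1 / p) < r powr (1 / p)" using p by (intro powr_less_mono2) auto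
        with that show False by simp
      qed
    qed
    then show ?thesis using r by (simp add: moment_gauge_def)
  qed
  then show ?thesis by (auto simp: moment_ball_def)
qed

lemma ext_root_moment_int: "ext_root p (moment_int \<epsilon> p m w) = ereal (moment_gauge \<epsilon> p m w)"
  using fin[of w] by (simp add: ext_root_def moment_gauge_def)

lemma moment_gauge_nonneg: "0 \<le> moment_gauge \<epsilon> p m w"
  by (simp add: moment_gauge_def)

lemma moment_gauge_scale: "moment_gauge \<epsilon> p m (t *\<^sub>R w) = t * moment_gauge \<epsilon> p m w" if "0 < t"
proof -
  have "moment_gauge \<epsilon> p m (t *\<^sub>R w) = (t powr p) powr (1 / p) * moment_gauge \<epsilon> p m w"
    unfolding moment_gauge_def using that p
    by (subst moment_int_scale[OF eps p m m_nonneg]) (simp_all add: enn2real_mult powr_mult)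
  then show ?thesis using p that by (simp add: powr_powr)
qed

lemma moment_gauge_0: "moment_gauge \<epsilon> p m 0 = 0"
  using p by (simp add: moment_gauge_def moment_int_0[OF eps p])

lemma moment_int_measurable [measurable]: "moment_int \<epsilon> p m \<in> borel_measurable borel"
proof -
  have "(\<lambda>x. m (snd x) * (case x of (w, z) \<Rightarrow> asym_pow \<epsilon> p w z)) \<in> borel_measurable (borel \<Otimes>\<^sub>M borel)"
    using asym_pow_measurable_pair[OF eps p]
    by (intro borel_measurable_times measurable_compose[OF measurable_snd m])
  then have "(\<lambda>x. ennreal (m (snd x) * asym_pow \<epsilon> p (fst x) (snd x))) \<in> borel_measurable (borel \<Otimes>\<^sub>M lborel)"
    by (simp add: split_beta measurable_cong_sets[OF sets_pair_measure_cong[OF refl sets_lborel] refl])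
  then show ?thesis
    unfolding moment_int_def[abs_def]
    by (intro lborel.borel_measurable_nn_integral) (simp add: split_beta)
qed

lemma moment_gauge_measurable [measurable]: "moment_gauge \<epsilon> p m \<in> borel_measurable borel"
  unfolding moment_gauge_def[abs_def] by measurable

lemmas moment_gauge_facts = moment_gauge_nonneg moment_gauge_scale moment_gauge_0
  closed_moment_ball[OF eps p m m_nonneg, folded moment_gauge_ball]
  convex_moment_ball[OF eps p m m_nonneg, folded moment_gauge_ball]

lemma convex_set_of_support_moment:
  "convex_set_of_support (\<lambda>w. ext_root p (moment_int \<epsilon> p m w)) = polar (moment_ball \<epsilon> p m)"
  unfolding ext_root_moment_int
  using convex_set_of_support_gauge[OF moment_gauge_facts] by (simp add: moment_gauge_ball)

lemma polar_polar_moment_ball: "polar (polar (moment_ball \<epsilon> p m)) = moment_ball \<epsilon> p m"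
  using polar_polar_gauge_ball[OF moment_gauge_facts] by (simp add: moment_gauge_ball)

end

section \<open>Volumes of tilted gauge balls\<close>

lemma AE_lborel_not_orthogonal:
  fixes u :: "'a::euclidean_space"
  assumes "u \<noteq> 0"
  shows "AE y in lborel. u \<bullet> y \<noteq> 0"
proof (rule AE_I)
  show "{y \<in> space lborel. \<not> u \<bullet> y \<noteq> 0} \<subseteq> {y. u \<bullet> y = 0}" by auto
  show "{y. u \<bullet> y = 0} \<in> sets lborel"
    by (simp add: borel_closed closed_hyperplane)
  show "emeasure lborel {y. u \<bullet> y = 0} = 0"
    using negligible_hyperplane[of u 0] assms \<open>{y. u \<bullet> y = 0} \<in> sets lborel\<close>
    by (simp add: negligible_iff_null_sets null_sets_def)
qed

lemma not_AE_False_lborel: "\<not> (AE y in (lborel :: 'a::euclidean_space measure). False)"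
proof
  assume "AE y in (lborel :: 'a measure). False"
  then have "emeasure lborel (UNIV :: 'a set) = 0"
    by (subst (asm) AE_iff_measurable[of UNIV]) auto
  then show False by simp
qed

lemma nn_integral_lborel_scale:
  fixes F :: "'a::euclidean_space \<Rightarrow> ennreal"
  assumes [measurable]: "F \<in> borel_measurable borel" and t: "t > 0"
  shows "(\<integral>\<^sup>+ y. F y \<partial>lborel) = ennreal (t ^ DIM('a)) * (\<integral>\<^sup>+ y. F (t *\<^sub>R y) \<partial>lborel)"
proof -
  have "(\<integral>\<^sup>+ y. F y \<partial>lborel)
      = (\<integral>\<^sup>+ y. F y \<partial>density (distr lborel borel (\<lambda>x. 0 + t *\<^sub>R x)) (\<lambda>_. ennreal (\<bar>t\<bar> ^ DIM('a))))"
    using t lborel_affine[of t "0::'a"] by simp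
  also have "\<dots> = (\<integral>\<^sup>+ y. ennreal (t ^ DIM('a)) * F y \<partial>distr lborel borel (\<lambda>x. 0 + t *\<^sub>R x))"
    using t by (subst nn_integral_density) auto
  also have "\<dots> = (\<integral>\<^sup>+ y. ennreal (t ^ DIM('a)) * F (t *\<^sub>R y) \<partial>lborel)"
    by (subst nn_integral_distr) auto
  also have "\<dots> = ennreal (t ^ DIM('a)) * (\<integral>\<^sup>+ y. F (t *\<^sub>R y) \<partial>lborel)"
    by (rule nn_integral_cmult) simp
  finally show ?thesis .
qed

lemma exp_minus_eq_nn_integral:
  "ennreal (exp (- a)) = (\<integral>\<^sup>+ t. ennreal (exp (- t)) * indicator {a..} t \<partial>lborel)"
proof -
  have "(\<integral>\<^sup>+ t. ennreal (exp (- t)) * indicator {a..} t \<partial>lborel) = ennreal (0 - (- exp (- a)))"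
  proof (rule nn_integral_FTC_atLeast)
    show "((\<lambda>t::real. - exp (- t)) \<longlongrightarrow> 0) at_top"
      using tendsto_minus[OF filterlim_compose[OF exp_at_bot filterlim_uminus_at_bot_at_top]] by simp
  qed (auto intro!: derivative_eq_intros)
  then show ?thesis by simp
qed

text \<open>The integral of a homogeneous function over \<open>{h \<le> 1}\<close> is, up to a factorial, its integral against
\<open>exp (- h)\<close>: write \<open>exp (- h y)\<close> as the integral of \<open>exp (- t)\<close> over \<open>t \<ge> h y\<close>, exchange the
integrals, and use that \<open>{h \<le> t}\<close> is \<open>t\<close> times \<open>{h \<le> 1}\<close>. The function \<open>\<phi>\<close> is \<open>ennreal\<close>-valued,
so \<open>\<lambda>y. ennreal (u \<bullet> y)\<close> can be inserted for the positive part of a linear form.\<close>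

lemma nn_integral_exp_minus_gauge:
  fixes h :: "'a::euclidean_space \<Rightarrow> real" and \<phi> :: "'a \<Rightarrow> ennreal"
  assumes [measurable]: "h \<in> borel_measurable borel" "\<phi> \<in> borel_measurable borel"
    and h: "\<And>y. 0 \<le> h y" "\<And>t y. 0 < t \<Longrightarrow> h (t *\<^sub>R y) = t * h y"
    and \<phi>: "\<And>t y. 0 < t \<Longrightarrow> \<phi> (t *\<^sub>R y) = ennreal (t ^ d) * \<phi> y"
  shows "(\<integral>\<^sup>+ y. ennreal (exp (- h y)) * \<phi> y \<partial>lborel)
    = ennreal (fact (DIM('a) + d)) * (\<integral>\<^sup>+ y. \<phi> y * indicator {y. h y \<le> 1} y \<partial>lborel)"
proof -
  let ?I = "\<integral>\<^sup>+ y. \<phi> y * indicator {y. h y \<le> 1} y \<partial>lborel"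
  have inner: "(\<integral>\<^sup>+ y. \<phi> y * indicator {y. h y \<le> t} y \<partial>lborel) = ennreal (t ^ (DIM('a) + d)) * ?I"
    if t: "t > 0" for t
  proof -
    have "(\<integral>\<^sup>+ y. \<phi> y * indicator {y. h y \<le> t} y \<partial>lborel)
        = ennreal (t ^ DIM('a)) * (\<integral>\<^sup>+ y. \<phi> (t *\<^sub>R y) * indicator {y. h y \<le> t} (t *\<^sub>R y) \<partial>lborel)"
      by (rule nn_integral_lborel_scale[OF _ t]) measurable
    also have "(\<lambda>y. \<phi> (t *\<^sub>R y) * indicator {y. h y \<le> t} (t *\<^sub>R y))
        = (\<lambda>y. ennreal (t ^ d) * (\<phi> y * indicator {y. h y \<le> 1} y))"
      using t by (auto simp: fun_eq_iff \<phi> h indicator_def mult.assoc mult_le_cancel_left1)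
    also have "(\<integral>\<^sup>+ y. ennreal (t ^ d) * (\<phi> y * indicator {y. h y \<le> 1} y) \<partial>lborel) = ennreal (t ^ d) * ?I"
      by (rule nn_integral_cmult) measurable
    finally show ?thesis
      using t by (simp add: power_add ennreal_mult mult.assoc)
  qed
  have "(\<integral>\<^sup>+ y. ennreal (exp (- h y)) * \<phi> y \<partial>lborel)
      = (\<integral>\<^sup>+ y. (\<integral>\<^sup>+ t. ennreal (exp (- t)) * (\<phi> y * (if h y \<le> t then 1 else 0)) \<partial>lborel) \<partial>lborel)"
  proof (rule nn_integral_cong)
    fix y
    have "ennreal (exp (- h y)) * \<phi> y = (\<integral>\<^sup>+ t. ennreal (exp (- t)) * indicator {h y..} t \<partial>lborel) * \<phi> y"
      by (subst exp_minus_eq_nn_integral) (rule refl)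
    also have "\<dots> = (\<integral>\<^sup>+ t. ennreal (exp (- t)) * indicator {h y..} t * \<phi> y \<partial>lborel)"
      by (rule nn_integral_multc[symmetric]) measurable
    also have "\<dots> = (\<integral>\<^sup>+ t. ennreal (exp (- t)) * (\<phi> y * (if h y \<le> t then 1 else 0)) \<partial>lborel)"
      by (intro nn_integral_cong) (simp add: indicator_def)
    finally show "ennreal (exp (- h y)) * \<phi> y = \<dots>" .
  qed
  also have "\<dots> = (\<integral>\<^sup>+ t. (\<integral>\<^sup>+ y. ennreal (exp (- t)) * (\<phi> y * (if h y \<le> t then 1 else 0)) \<partial>lborel) \<partial>lborel)"
    by (rule lborel_pair.Fubini'[symmetric]) measurable
  also have "\<dots> = (\<integral>\<^sup>+ t. ennreal (t ^ (DIM('a) + d) * exp (- t)) * indicator {0..} t * ?I \<partial>lborel)"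
  proof (rule nn_integral_cong_AE)
    have "AE t in lborel. t \<noteq> (0::real)" by (rule AE_lborel_singleton)
    then show "AE t in lborel. (\<integral>\<^sup>+ y. ennreal (exp (- t)) * (\<phi> y * (if h y \<le> t then 1 else 0)) \<partial>lborel)
       = ennreal (t ^ (DIM('a) + d) * exp (- t)) * indicator {0..} t * ?I"
    proof eventually_elim
      case (elim t)
      have "(\<integral>\<^sup>+ y. ennreal (exp (- t)) * (\<phi> y * (if h y \<le> t then 1 else 0)) \<partial>lborel)
         = (\<integral>\<^sup>+ y. ennreal (exp (- t)) * (\<phi> y * indicator {y. h y \<le> t} y) \<partial>lborel)"
        by (intro nn_integral_cong) (simp add: indicator_def)
      also have "\<dots> = ennreal (exp (- t)) * (\<integral>\<^sup>+ y. \<phi> y * indicator {y. h y \<le> t} y \<partial>lborel)"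
        by (rule nn_integral_cmult) measurable
      also have "\<dots> = ennreal (t ^ (DIM('a) + d) * exp (- t)) * indicator {0..} t * ?I"
      proof (cases "t > 0")
        case True
        then have "ennreal (t ^ (DIM('a) + d) * exp (- t)) = ennreal (exp (- t)) * ennreal (t ^ (DIM('a) + d))"
          by (subst mult.commute) (rule ennreal_mult', simp)
        with True show ?thesis by (simp only: inner[OF True]) (simp add: mult.assoc)
      next
        case False
        then have "t < 0" using elim by simp
        then have "\<not> h y \<le> t" for y using h(1)[of y] by linarith
        then have "{y. h y \<le> t} = {}" by blast
        then show ?thesis using \<open>t < 0\<close> by simp
      qed
      finally show ?case .
    qed
  qed
  also have "\<dots> = (\<integral>\<^sup>+ t. ennreal (t ^ (DIM('a) + d) * exp (- t)) * indicator {0..} t \<partial>lborel) * ?I"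
    by (rule nn_integral_multc) measurable
  also have "(\<integral>\<^sup>+ t. ennreal (t ^ (DIM('a) + d) * exp (- t)) * indicator {0..} t \<partial>lborel) = ennreal (fact (DIM('a) + d))"
    by (simp add: nn_intergal_power_times_exp_Ici)
  finally show ?thesis .
qed

text \<open>A body whose polar \<open>{h \<le> 1}\<close> is centred has its Santalo point at the origin. Passing to integrals
against \<open>exp (- h)\<close> turns the tilt \<open>h y - u \<bullet> y\<close> into the factor \<open>exp (u \<bullet> y)\<close>, and
\<open>exp x \<ge> 1 + x\<close>, strict for \<open>x \<noteq> 0\<close>. The linear term integrates to zero because the
centroid vanishes; as extended nonnegative integrals do not subtract, its negative part is carried on
the other side of the inequality.\<close>

lemma emeasure_gauge_ball_less_tilted:
  fixes h :: "'a::euclidean_space \<Rightarrow> real"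
  assumes [measurable]: "h \<in> borel_measurable borel"
    and h: "\<And>y. 0 \<le> h y" "\<And>t y. 0 < t \<Longrightarrow> h (t *\<^sub>R y) = t * h y"
    and bd: "bounded {y. h y \<le> 1}"
    and centred: "(LINT z:{y. h y \<le> 1}|lborel. z) = 0"
    and u: "u \<noteq> 0" "\<And>y. u \<bullet> y \<le> h y"
  shows "emeasure lborel {y. h y \<le> 1} < emeasure lborel {y. h y - u \<bullet> y \<le> 1}"
proof -
  define L where "L = {y. h y \<le> 1}"
  have [measurable]: "L \<in> sets borel" unfolding L_def by measurable
  have vol: "emeasure lborel L < \<infinity>"
    using bd emeasure_bounded_finite unfolding L_def by blast
  obtain R where R: "\<And>y. y \<in> L \<Longrightarrow> norm y \<le> R" using bd by (auto simp: L_def bounded_iff)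
  have int: "set_integrable lborel L (\<lambda>z. z)"
    unfolding set_integrable_def
  proof (rule Bochner_Integration.integrable_bound)
    show "integrable lborel (\<lambda>z. R * indicator L z :: real)" using vol by simp
    show "AE z in lborel. norm (indicat_real L z *\<^sub>R z) \<le> norm (R * indicator L z :: real)"
      using R by (auto simp: indicator_def intro: order_trans[OF _ abs_ge_self])
  qed measurable
  define g where "g = (\<lambda>z. u \<bullet> (indicat_real L z *\<^sub>R z))"
  have g: "integrable lborel g" "integral\<^sup>L lborel g = 0"
  proof -
    have i: "integrable lborel (\<lambda>z. indicat_real L z *\<^sub>R z)" using int by (simp add: set_integrable_def)
    show "integrable lborel g" unfolding g_def by (intro integrable_inner_right i)
    have "integral\<^sup>L lborel g = u \<bullet> (LINT z|lborel. indicat_real L z *\<^sub>R z)"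
      unfolding g_def by (intro integral_inner_right i)
    then show "integral\<^sup>L lborel g = 0"
      using centred by (simp add: set_lebesgue_integral_def L_def)
  qed
  define P where "P = (\<integral>\<^sup>+ z. ennreal (g z) \<partial>lborel)"
  have gfin: "P < \<infinity>" "(\<integral>\<^sup>+ z. ennreal (- g z) \<partial>lborel) < \<infinity>"
    using g(1) unfolding P_def real_integrable_def by (auto simp: less_top)
  have P: "(\<integral>\<^sup>+ z. ennreal (- g z) \<partial>lborel) = P"
    using g(2) real_lebesgue_integral_def[OF g(1)] gfin unfolding P_def
    by (metis eq_iff_diff_eq_0 ennreal_enn2real infinity_ennreal_def)
  define n where "n = DIM('a)"
  \<comment> \<open>Both signs of the linear form have the same integral \<open>P\<close>, so they cancel at the end.\<close>
  have pos: "(\<integral>\<^sup>+ y. ennreal (exp (- h y)) * ennreal (v \<bullet> y) \<partial>lborel)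
      = ennreal (fact (n + 1)) * (\<integral>\<^sup>+ y. ennreal (v \<bullet> y) * indicator L y \<partial>lborel)" for v
    unfolding L_def n_def using h
    by (intro nn_integral_exp_minus_gauge) (auto simp: ennreal_mult')
  have P1: "(\<integral>\<^sup>+ y. ennreal (u \<bullet> y) * indicator L y \<partial>lborel) = P"
    unfolding P_def g_def by (intro nn_integral_cong) (auto simp: indicator_def)
  have P2: "(\<integral>\<^sup>+ y. ennreal ((- u) \<bullet> y) * indicator L y \<partial>lborel) = P"
    unfolding P[symmetric] g_def by (intro nn_integral_cong) (auto simp: indicator_def)
  have one: "(\<integral>\<^sup>+ y. ennreal (exp (- h' y)) \<partial>lborel) = ennreal (fact n) * emeasure lborel {y. h' y \<le> 1}"
    if [measurable]: "h' \<in> borel_measurable borel" and "\<And>y. 0 \<le> h' y" "\<And>t y. 0 < t \<Longrightarrow> h' (t *\<^sub>R y) = t * h' y"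
    for h' :: "'a \<Rightarrow> real"
    using nn_integral_exp_minus_gauge[of h' "\<lambda>_. 1" 0] that unfolding n_def by simp
  have A: "(\<integral>\<^sup>+ y. ennreal (exp (- h y)) + ennreal (exp (- h y)) * ennreal (u \<bullet> y) \<partial>lborel)
      = ennreal (fact n) * emeasure lborel L + ennreal (fact (n + 1)) * P"
    using one[of h] h pos[of u] P1 unfolding L_def by (subst nn_integral_add) auto
  have B: "(\<integral>\<^sup>+ y. ennreal (exp (- (h y - u \<bullet> y))) + ennreal (exp (- h y)) * ennreal ((- u) \<bullet> y) \<partial>lborel)
      = ennreal (fact n) * emeasure lborel {y. h y - u \<bullet> y \<le> 1} + ennreal (fact (n + 1)) * P"
    using one[of "\<lambda>y. h y - u \<bullet> y"] h u(2) pos[of "- u"] P2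
    by (subst nn_integral_add) (auto simp: algebra_simps)
  have key: "ennreal (exp (- h y)) + ennreal (exp (- h y)) * ennreal (u \<bullet> y)
      \<le> ennreal (exp (- (h y - u \<bullet> y))) + ennreal (exp (- h y)) * ennreal ((- u) \<bullet> y)
    \<and> (u \<bullet> y \<noteq> 0 \<longrightarrow> ennreal (exp (- h y)) + ennreal (exp (- h y)) * ennreal (u \<bullet> y)
      < ennreal (exp (- (h y - u \<bullet> y))) + ennreal (exp (- h y)) * ennreal ((- u) \<bullet> y))" for y
  proof -
    define x where "x = u \<bullet> y"
    define e where "e = exp (- h y)"
    have e: "e > 0" by (simp add: e_def)
    have le: "1 + x \<le> exp x" by (rule exp_ge_add_one_self)
    have ne: "x \<noteq> 0 \<Longrightarrow> 1 + x < exp x" using exp_minus_greater[of "- x"] by simp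
    have ex: "exp (- (h y - u \<bullet> y)) = e * exp x" by (simp add: e_def x_def exp_diff exp_minus divide_simps)
    have 1: "ennreal e + ennreal e * ennreal x = ennreal (e * (1 + max x 0))"
      using e by (cases "x \<ge> 0") (auto simp: ennreal_neg max_def ennreal_mult'[symmetric] ennreal_plus[symmetric] algebra_simps simp del: ennreal_plus)
    have 2: "ennreal (e * exp x) + ennreal e * ennreal (- x) = ennreal (e * (exp x + max (- x) 0))"
    proof (cases "x \<ge> 0")
      case False
      have "ennreal (e * exp x) + ennreal e * ennreal (- x) = ennreal (e * exp x) + ennreal (e * (- x))"
        using e by (simp add: ennreal_mult'[symmetric])
      also have "\<dots> = ennreal (e * exp x + e * (- x))"
        using e False by (intro ennreal_plus[symmetric] mult_nonneg_nonneg) auto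
      finally show ?thesis using False by (simp add: max_def algebra_simps)
    qed (simp add: ennreal_neg max_def)
    have "e * (1 + max x 0) \<le> e * (exp x + max (- x) 0)" proof (intro mult_left_mono)
      show "1 + max x 0 \<le> exp x + max (- x) 0" using le by linarith
    qed (use e in auto)
    moreover have "x \<noteq> 0 \<Longrightarrow> e * (1 + max x 0) < e * (exp x + max (- x) 0)"
    proof (intro mult_strict_left_mono)
      show "1 + max x 0 < exp x + max (- x) 0" if "x \<noteq> 0" using ne[OF that] by linarith
    qed (use e in auto)
    ultimately have "ennreal e + ennreal e * ennreal x \<le> ennreal (e * exp x) + ennreal e * ennreal (- x)
      \<and> (x \<noteq> 0 \<longrightarrow> ennreal e + ennreal e * ennreal x < ennreal (e * exp x) + ennreal e * ennreal (- x))"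
      unfolding 1 2 using e by (auto intro!: ennreal_leI ennreal_lessI add_pos_nonneg)
    then show ?thesis unfolding ex by (simp add: e_def x_def)
  qed
  have "(\<integral>\<^sup>+ y. ennreal (exp (- h y)) + ennreal (exp (- h y)) * ennreal (u \<bullet> y) \<partial>lborel)
     < (\<integral>\<^sup>+ y. ennreal (exp (- (h y - u \<bullet> y))) + ennreal (exp (- h y)) * ennreal ((- u) \<bullet> y) \<partial>lborel)"
  proof (rule nn_integral_less)
    show "(\<integral>\<^sup>+ y. ennreal (exp (- h y)) + ennreal (exp (- h y)) * ennreal (u \<bullet> y) \<partial>lborel) \<noteq> \<infinity>"
      unfolding A using vol gfin(1) by (simp add: ennreal_mult_eq_top_iff less_top)
    show "\<not> (AE y in lborel. ennreal (exp (- (h y - u \<bullet> y))) + ennreal (exp (- h y)) * ennreal ((- u) \<bullet> y)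
        \<le> ennreal (exp (- h y)) + ennreal (exp (- h y)) * ennreal (u \<bullet> y))"
    proof
      assume "AE y in lborel. ennreal (exp (- (h y - u \<bullet> y))) + ennreal (exp (- h y)) * ennreal ((- u) \<bullet> y)
        \<le> ennreal (exp (- h y)) + ennreal (exp (- h y)) * ennreal (u \<bullet> y)"
      with AE_lborel_not_orthogonal[OF u(1)] have "AE y in (lborel :: 'a measure). False"
        by eventually_elim (use key in \<open>auto simp: not_le[symmetric] simp del: not_le\<close>)
      then show False using not_AE_False_lborel by blast
    qed
  qed (use key in auto)
  then have less: "ennreal (fact n) * emeasure lborel L + ennreal (fact (n + 1)) * P
      < ennreal (fact n) * emeasure lborel {y. h y - u \<bullet> y \<le> 1} + ennreal (fact (n + 1)) * P"
    unfolding A B .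
  show ?thesis
    unfolding L_def[symmetric]
  proof (rule ccontr)
    assume "\<not> emeasure lborel L < emeasure lborel {y. h y - u \<bullet> y \<le> 1}"
    then have "ennreal (fact n) * emeasure lborel {y. h y - u \<bullet> y \<le> 1} + ennreal (fact (n + 1)) * P
      \<le> ennreal (fact n) * emeasure lborel L + ennreal (fact (n + 1)) * P"
      by (intro add_right_mono mult_left_mono) auto
    with less show False using leD by blast
  qed
qed

section \<open>Boundedness of moment balls and the centroid criterion\<close>

lemma AE_lborel_open_witness:
  fixes S :: "'a::euclidean_space set"
  assumes "AE z in lborel. P z" "open S" "S \<noteq> {}"
  obtains z where "z \<in> S" "P z"
proof -
  have "\<exists>z\<in>S. P z"
  proof (rule ccontr)
    assume "\<not> (\<exists>z\<in>S. P z)"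
    then have "S \<subseteq> {z. \<not> P z}" by blast
    moreover obtain N where "N \<in> null_sets lborel" "{z \<in> space lborel. \<not> P z} \<subseteq> N"
      using assms(1) by (auto simp: eventually_ae_filter)
    ultimately have "S \<subseteq> N" "negligible N"
      by (auto simp: negligible_iff_null_sets null_sets_completionI)
    then show False using open_not_negligible[OF assms(2,3)] negligible_subset by blast
  qed
  then show ?thesis using that by blast
qed

context
  fixes \<epsilon> p :: real
  assumes eps: "0 \<le> \<epsilon>" "\<epsilon> \<le> 1" and p: "1 \<le> p"
begin

text \<open>Compactness: if unit balls of converging weights contain points tending to infinity, their directions
accumulate at a direction in which the limit weight has vanishing moment, by homogeneity and Fatou.\<close>

lemma moment_int_escape:
  fixes w :: "nat \<Rightarrow> 'a::euclidean_space"
  assumes [measurable]: "\<And>j. m j \<in> borel_measurable borel" "m' \<in> borel_measurable borel"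
    and nonneg: "\<And>j z. 0 \<le> m j z"
    and lim: "AE z in lborel. (\<lambda>j. m j z) \<longlonglongrightarrow> m' z"
    and w: "\<And>j. w j \<in> moment_ball \<epsilon> p (m j)" "\<And>j. real j < norm (w j)"
  obtains u r where "strict_mono r" "norm u = 1" "(\<lambda>j. w (r j) /\<^sub>R norm (w (r j))) \<longlonglongrightarrow> u"
    "moment_int \<epsilon> p m' u = 0"
proof -
  define v where "v j = w j /\<^sub>R norm (w j)" for j
  have pos: "norm (w j) > 0" for j using w(2)[of j] by (meson of_nat_0_le_iff order_le_less_trans)
  have "\<forall>j. v j \<in> sphere 0 1" using pos by (simp add: v_def)
  then obtain u r where u: "u \<in> sphere 0 1" and r: "strict_mono r" and vu: "(v \<circ> r) \<longlonglongrightarrow> u"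
    using compact_sphere[of "0::'a" 1] unfolding compact_def by blast
  have "moment_int \<epsilon> p m' u \<le> liminf (\<lambda>j. moment_int \<epsilon> p (m (r j)) ((v \<circ> r) j))"
  proof (intro moment_int_fatou eps p vu nonneg)
    show "AE z in lborel. (\<lambda>j. m (r j) z) \<longlonglongrightarrow> m' z"
      using lim by eventually_elim (use r in \<open>auto dest: LIMSEQ_subseq_LIMSEQ simp: o_def\<close>)
  qed simp_all
  also have "\<dots> \<le> liminf (\<lambda>j. ennreal (norm (w (r j)) powr - p))"
  proof (intro Liminf_mono always_eventually allI)
    fix j
    have "moment_int \<epsilon> p (m (r j)) ((v \<circ> r) j)
        = ennreal (inverse (norm (w (r j))) powr p) * moment_int \<epsilon> p (m (r j)) (w (r j))"
      unfolding v_def o_def by (rule moment_int_scale[OF eps p]) (auto simp: nonneg)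
    also have "\<dots> \<le> ennreal (inverse (norm (w (r j))) powr p) * 1"
      using w(1) by (intro mult_left_mono) (auto simp: moment_ball_def)
    finally show "moment_int \<epsilon> p (m (r j)) ((v \<circ> r) j) \<le> ennreal (norm (w (r j)) powr - p)"
      using pos[of "r j"] by (simp add: powr_minus inverse_powr)
  qed
  also have "\<dots> = 0"
  proof -
    have "filterlim (\<lambda>j. norm (w (r j))) at_top sequentially"
    proof (rule filterlim_at_top_mono[OF filterlim_real_sequentially])
      show "\<forall>\<^sub>F j in sequentially. real j \<le> norm (w (r j))"
        using seq_suble[OF r] w(2) by (intro always_eventually allI) (meson less_imp_le of_nat_mono order_le_less_trans)
    qed
    then have "(\<lambda>j. norm (w (r j)) powr - p) \<longlonglongrightarrow> 0" using p by (intro tendsto_neg_powr) auto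
    then have "(\<lambda>j. ennreal (norm (w (r j)) powr - p)) \<longlonglongrightarrow> ennreal 0" by (rule tendsto_ennrealI)
    then show ?thesis by (simp add: lim_imp_Liminf)
  qed
  finally have "moment_int \<epsilon> p m' u = 0" by simp
  moreover have "(\<lambda>j. w (r j) /\<^sub>R norm (w (r j))) \<longlonglongrightarrow> u" using vu by (simp add: o_def v_def)
  ultimately show ?thesis using that[OF r] u by auto
qed

lemma bounded_moment_ball:
  fixes m :: "'a::euclidean_space \<Rightarrow> real"
  assumes [measurable]: "m \<in> borel_measurable borel" and m: "\<And>z. 0 \<le> m z"
    and pos: "\<And>u. u \<noteq> 0 \<Longrightarrow> moment_int \<epsilon> p m u \<noteq> 0"
  shows "bounded (moment_ball \<epsilon> p m)"
proof (rule ccontr)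
  assume "\<not> bounded (moment_ball \<epsilon> p m)"
  then have "\<forall>j. \<exists>w. w \<in> moment_ball \<epsilon> p m \<and> real j < norm w"
    unfolding bounded_iff by (meson not_le)
  then obtain w where w: "\<And>j. w j \<in> moment_ball \<epsilon> p m" "\<And>j. real j < norm (w j)" by metis
  obtain u where "norm u = 1" "moment_int \<epsilon> p m u = 0"
    by (rule moment_int_escape[of "\<lambda>_. m" m w]) (use m w in auto)
  then show False using pos[of u] by (metis norm_zero zero_neq_one)
qed

lemma moment_int_eq_0_iff_AE:
  assumes [measurable]: "m \<in> borel_measurable borel" and m: "\<And>z. 0 \<le> m z"
  shows "moment_int \<epsilon> p m u = 0 \<longleftrightarrow> (AE z in lborel. m z * asym_pow \<epsilon> p u z = 0)"
proof -
  note [measurable] = asym_pow_measurable[OF eps p]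
  have "moment_int \<epsilon> p m u = 0 \<longleftrightarrow> (AE z in lborel. ennreal (m z * asym_pow \<epsilon> p u z) = 0)"
    unfolding moment_int_def by (rule nn_integral_0_iff_AE) simp
  also have "\<dots> \<longleftrightarrow> (AE z in lborel. m z * asym_pow \<epsilon> p u z = 0)"
  proof -
    have "0 \<le> m z * asym_pow \<epsilon> p u z" for z
      by (intro mult_nonneg_nonneg m asym_pow_nonneg[OF eps p])
    then show ?thesis by (simp only: ennreal_eq_0_iff) (simp only: eq_iff simp_thms)
  qed
  finally show ?thesis .
qed

text \<open>For \<open>\<epsilon> = 0\<close> or \<open>\<epsilon> = 1\<close> only one side of the hyperplane orthogonal to \<open>u\<close> contributes, so a ball
centred at the origin is used, which meets both sides.\<close>

lemma moment_int_indicator_nonzero: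
  fixes u :: "'a::euclidean_space"
  assumes [measurable]: "K \<in> sets borel" and r: "0 < r" "ball 0 r \<subseteq> K" and u: "u \<noteq> 0"
  shows "moment_int \<epsilon> p (indicator K) u \<noteq> 0"
proof
  assume "moment_int \<epsilon> p (indicator K) u = 0"
  then have ae: "AE z in lborel. indicator K z * asym_pow \<epsilon> p u z = 0"
    by (subst (asm) moment_int_eq_0_iff_AE) auto
  define x where "x = (r / (2 * norm u)) *\<^sub>R u"
  have x: "norm x < r" "u \<bullet> x > 0" using r u by (auto simp: x_def)
  obtain z where z: "z \<in> {z. u \<bullet> z > 0} \<inter> ball 0 r" "indicator K z * asym_pow \<epsilon> p u z = 0"
  proof (rule AE_lborel_open_witness[OF ae])
    show "open ({z. u \<bullet> z > 0} \<inter> ball 0 r)" using open_halfspace_gt[of 0 u] by auto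
    show "{z. u \<bullet> z > 0} \<inter> ball 0 r \<noteq> {}" using x by auto
  qed
  obtain y where y: "y \<in> {z. u \<bullet> z < 0} \<inter> ball 0 r" "indicator K y * asym_pow \<epsilon> p u y = 0"
  proof (rule AE_lborel_open_witness[OF ae])
    show "open ({z. u \<bullet> z < 0} \<inter> ball 0 r)" using open_halfspace_lt[of u 0] by auto
    have "- x \<in> {z. u \<bullet> z < 0} \<inter> ball 0 r" using x by auto
    then show "{z. u \<bullet> z < 0} \<inter> ball 0 r \<noteq> {}" by blast
  qed
  have "z \<in> K" "y \<in> K" using y z r by auto
  then have "asym_pow \<epsilon> p u z = 0" "asym_pow \<epsilon> p u y = 0" using y z by auto
  then show False using y z by (auto simp: asym_pow_def max_def split: if_splits)
qed

text \<open>The radius depends only on the bounds for the weight, which gives uniformity over translates.\<close>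

lemma small_cball_in_moment_ball:
  fixes B R :: real
  assumes B: "0 \<le> B" and R: "0 < R"
  obtains d where "0 < d"
    "\<And>m :: 'a::euclidean_space \<Rightarrow> real. (\<And>z. m z \<le> B * indicator (cball 0 R) z) \<Longrightarrow> cball 0 d \<subseteq> moment_ball \<epsilon> p m"
proof -
  define V where "V = measure lborel (cball 0 R :: 'a set)"
  have V: "emeasure lborel (cball 0 R :: 'a set) = ennreal V" "0 \<le> V"
    unfolding V_def using emeasure_lborel_cball_finite[of "0::'a" R]
    by (auto simp: emeasure_eq_ennreal_measure less_top)
  \<comment> \<open>With \<open>q \<le> 1\<close> and \<open>p \<ge> 1\<close> one has \<open>q powr p \<le> q\<close>, so the power does not enter the choice.\<close>
  define q where "q = 1 / (B * V + 1)"
  have BV: "0 \<le> B * V" using B V by simp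
  have q: "0 < q" "q \<le> 1" using BV by (auto simp: q_def)
  show ?thesis
  proof (rule that[of "q / R"])
    show "0 < q / R" using q R by simp
    fix m :: "'a \<Rightarrow> real" assume m: "\<And>z. m z \<le> B * indicator (cball 0 R) z"
    show "cball 0 (q / R) \<subseteq> moment_ball \<epsilon> p m"
    proof
      fix w :: 'a assume "w \<in> cball 0 (q / R)"
      then have w: "norm w * R \<le> q" using R by (simp add: divide_simps)
      have "(norm w * R) powr p \<le> q powr p" using w R p by (intro powr_mono2) auto
      also have "\<dots> \<le> q powr 1" using q p by (intro powr_mono') auto
      finally have "(norm w * R) powr p \<le> q" using q by simp
      then have "B * (norm w * R) powr p * V \<le> B * q * V"
        using B V by (intro mult_right_mono mult_left_mono)
      also have "\<dots> \<le> 1" using BV by (simp add: q_def divide_simps mult.commute add_nonneg_pos)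
      finally have "ennreal (B * (norm w * R) powr p) * emeasure lborel (cball 0 R :: 'a set) \<le> 1"
        using V by (simp add: ennreal_mult''[symmetric])
      then show "w \<in> moment_ball \<epsilon> p m"
        using moment_int_bounded_support_finite[OF eps p m B, of w] unfolding moment_ball_def by simp
    qed
  qed
qed

text \<open>The moment body of \<open>K\<close> is the polar of the moment ball of its indicator, and the bipolar theorem
identifies its polar with that ball; both conclusions then express that the ball is centred.\<close>

lemma centred_moment_ball_santalo:
  fixes K :: "'a::euclidean_space set"
  assumes K: "compact K" and r: "0 < r" "ball 0 r \<subseteq> K"
    and centred: "(LINT z:moment_ball \<epsilon> p (indicator K)|lborel. z) = 0"
  shows "is_santalo_point (moment_body_set \<epsilon> p K) 0"
    and "center_of_mass (polar_moment_set \<epsilon> p K) = 0"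
proof -
  define m :: "'a \<Rightarrow> real" where "m = indicator K"
  have [measurable]: "K \<in> sets borel" using K by (simp add: borel_compact)
  have mm [measurable]: "m \<in> borel_measurable borel" by (simp add: m_def)
  have m0: "0 \<le> m z" for z by (simp add: m_def)
  obtain R where "0 < R" "\<forall>x\<in>K. norm x \<le> R"
    using compact_imp_bounded[OF K] unfolding bounded_pos by blast
  then have R: "0 < R" "K \<subseteq> cball 0 R" by auto
  have mR: "m z \<le> 1 * indicator (cball 0 R) z" for z
    using R by (auto simp: m_def indicator_def)
  have fin: "moment_int \<epsilon> p m w < \<infinity>" for w
    by (rule moment_int_finite[OF eps p mR]) simp
  have L: "moment_ball \<epsilon> p m = {y. moment_gauge \<epsilon> p m y \<le> 1}" (is "?L = _")
    by (rule moment_gauge_ball[OF eps p mm m0 fin, symmetric])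
  note facts = moment_gauge_facts[OF eps p mm m0 fin]
  have body: "moment_body_set \<epsilon> p K = polar ?L"
  proof -
    have "(\<integral>\<^sup>+ z\<in>K. ennreal (asym_pow \<epsilon> p y z) \<partial>lborel) = moment_int \<epsilon> p m y" for y
      unfolding moment_int_def m_def by (intro nn_integral_cong) (auto simp: indicator_def)
    then show ?thesis
      unfolding moment_body_set_def using convex_set_of_support_moment[OF eps p mm m0 fin] by simp
  qed
  have "polar_moment_set \<epsilon> p K = ?L"
    unfolding polar_moment_set_def body by (rule polar_polar_moment_ball[OF eps p mm m0 fin])
  then show "center_of_mass (polar_moment_set \<epsilon> p K) = 0"
    using centred by (simp add: center_of_mass_def m_def)
  have bdL: "bounded ?L"
    unfolding m_def using r
    by (intro bounded_moment_ball moment_int_indicator_nonzero[of K r]) auto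
  obtain d where d: "0 < d" "cball 0 d \<subseteq> ?L"
    using small_cball_in_moment_ball[of 1 R] R mR by (metis zero_le_one)
  have cb: "convex_body (polar ?L)"
    unfolding convex_body_def compact_eq_bounded_closed
  proof (intro conjI closed_polar convex_polar)
    have "norm x \<le> 1 / d" if "x \<in> polar ?L" for x
    proof (cases "x = 0")
      case False
      then have "(d / norm x) *\<^sub>R x \<in> ?L" using d by auto
      then have "x \<bullet> ((d / norm x) *\<^sub>R x) \<le> 1" using that by (auto simp: polar_def)
      then show ?thesis using d False by (simp add: power2_norm_eq_inner[symmetric] power2_eq_square divide_simps mult.commute)
    qed (use d in simp)
    then show "bounded (polar ?L)" by (auto simp: bounded_iff)
    obtain \<rho> where \<rho>: "0 < \<rho>" "\<And>y. y \<in> ?L \<Longrightarrow> norm y \<le> \<rho>" using bdL by (auto simp: bounded_pos)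
    have "ball 0 (1 / \<rho>) \<subseteq> polar ?L"
    proof
      fix x :: 'a assume "x \<in> ball 0 (1 / \<rho>)"
      then have x: "norm x \<le> 1 / \<rho>" by simp
      have "x \<bullet> y \<le> 1" if "y \<in> ?L" for y
      proof -
        have "x \<bullet> y \<le> norm x * norm y" by (rule norm_cauchy_schwarz)
        also have "\<dots> \<le> (1 / \<rho>) * \<rho>" using x \<rho>(2)[OF that] \<rho>(1) by (intro mult_mono) auto
        finally show ?thesis using \<rho>(1) by simp
      qed
      then show "x \<in> polar ?L" by (simp add: polar_def)
    qed
    then have "0 \<in> interior (polar ?L)" using \<rho>(1) unfolding mem_interior
      by (intro exI[of _ "1 / \<rho>"]) simp
    then show "interior (polar ?L) \<noteq> {}" by blast
  qed
  define F where "F u = emeasure lborel (polar ((\<lambda>x. x - u) ` polar ?L))" for u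
  have F: "F u = emeasure lborel {y. moment_gauge \<epsilon> p m y - u \<bullet> y \<le> 1}" for u
    unfolding F_def L using polar_translate_polar_gauge_ball[OF facts] by simp
  have less: "F 0 < F u" if "u \<in> polar ?L" "u \<noteq> 0" for u
  proof -
    have "u \<bullet> y \<le> moment_gauge \<epsilon> p m y" for y
      using that(1) polar_gauge_ball[OF facts] unfolding L by blast
    then have "emeasure lborel {y. moment_gauge \<epsilon> p m y \<le> 1} < emeasure lborel {y. moment_gauge \<epsilon> p m y - u \<bullet> y \<le> 1}"
      using that(2) bdL centred facts(1,2) moment_gauge_measurable[OF eps p mm m0 fin]
      by (intro emeasure_gauge_ball_less_tilted) (auto simp: L[symmetric] m_def[symmetric])
    then show ?thesis by (simp add: F)
  qed
  have "0 \<in> polar ?L" by (simp add: polar_def)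
  then have "is_arg_min F (\<lambda>u. u \<in> polar ?L) t \<longleftrightarrow> t = 0" for t
    using less unfolding is_arg_min_def by (metis order.asym)
  then show "is_santalo_point (moment_body_set \<epsilon> p K) 0"
    unfolding is_santalo_point_def body using cb by (simp add: F_def[abs_def])
qed

end

section \<open>Reflections\<close>

lemma distr_lborel_uminus: "distr lborel borel uminus = (lborel :: 'a::euclidean_space measure)"
  using lborel_affine[of "-1" "0::'a"] by (simp add: density_1 fun_eq_iff cong: distr_cong)

lemma set_integral_symmetric_eq_0:
  fixes L :: "'a::euclidean_space set"
  assumes [measurable]: "L \<in> sets borel" and sym: "\<And>z. - z \<in> L \<longleftrightarrow> z \<in> L"
  shows "(LINT z:L|lborel. z) = 0"
proof -
  have "(LINT z:L|lborel. z) = (LINT z|distr lborel borel uminus. indicat_real L z *\<^sub>R (z::'a))"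
    by (simp add: set_lebesgue_integral_def distr_lborel_uminus)
  also have "\<dots> = (LINT z|lborel. indicat_real L (- z) *\<^sub>R (- z))"
    by (rule integral_distr) measurable
  also have "\<dots> = (LINT z|lborel. - (indicat_real L z *\<^sub>R z))"
    by (simp add: indicator_def sym)
  also have "\<dots> = - (LINT z:L|lborel. z)" by (simp add: set_lebesgue_integral_def)
  finally have "(LINT z:L|lborel. z) + (LINT z:L|lborel. z) = 0"
    unfolding eq_neg_iff_add_eq_0 .
  then have "2 *\<^sub>R (LINT z:L|lborel. z) = 0" unfolding scaleR_2 .
  then show ?thesis by simp
qed

lemma asym_pow_0: "asym_pow 0 p y z = max (y \<bullet> z) 0 powr p"
  by (simp add: asym_pow_def)

lemma moment_int_mono:
  assumes "\<And>z. m z * asym_pow 0 p v z \<le> m' z * asym_pow 0 p w z"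
  shows "moment_int 0 p m v \<le> moment_int 0 p m' w"
  unfolding moment_int_def by (intro nn_integral_mono ennreal_leI assms)

lemma asym_pow_0_nonneg: "0 \<le> asym_pow 0 p y z"
  by (simp add: asym_pow_def)

lemma moment_int_1: "moment_int 1 p m w = moment_int 0 p m (- w)"
  by (simp add: moment_int_def asym_pow_def)

lemma moment_int_half_minus: "moment_int (1 / 2) p m (- w) = moment_int (1 / 2) p m w"
  by (simp add: moment_int_def asym_pow_def add.commute)

text \<open>Invariance of Lebesgue measure under \<open>z \<mapsto> - z\<close>.\<close>

lemma moment_int_reflect:
  fixes m :: "'a::euclidean_space \<Rightarrow> real"
  assumes p: "1 \<le> p" and [measurable]: "m \<in> borel_measurable borel"
  shows "moment_int 0 p (\<lambda>z. m (- z)) (- w) = moment_int 0 p m w"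
proof -
  have [measurable]: "(\<lambda>z. asym_pow 0 p w (z::'a)) \<in> borel_measurable borel"
    by (rule asym_pow_measurable) (use p in auto)
  have "moment_int 0 p m w = (\<integral>\<^sup>+ z. ennreal (m z * asym_pow 0 p w z) \<partial>distr lborel borel uminus)"
    by (simp add: moment_int_def distr_lborel_uminus)
  also have "\<dots> = (\<integral>\<^sup>+ z. ennreal (m (- z) * asym_pow 0 p w (- z)) \<partial>lborel)"
    by (rule nn_integral_distr) measurable
  finally show ?thesis by (simp add: moment_int_def asym_pow_def)
qed

section \<open>Translates of a compactly supported weight\<close>

text \<open>The bounds \<open>B\<close> and \<open>R\<close> are parameters because the estimates below have to be uniform in the translation.\<close>

locale compact_weight =
  fixes f :: "'a::euclidean_space \<Rightarrow> real" and p B R :: real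
  assumes p: "1 \<le> p"
    and cont: "continuous_on UNIV f"
    and nonneg: "0 \<le> f x"
    and nonzero: "\<exists>x. f x \<noteq> 0"
    and bound: "0 \<le> B" "f x \<le> B"
    and supp: "0 < R" "f x \<noteq> 0 \<Longrightarrow> norm x \<le> R"
begin

lemma translate_measurable [measurable]: "translate f c \<in> borel_measurable borel"
  unfolding translate_def
  by (intro borel_measurable_continuous_onI continuous_on_compose2[OF cont] continuous_intros) auto

lemma translate_nonneg: "0 \<le> translate f c z"
  by (simp add: translate_def nonneg)

lemma translate_le: "translate f c z \<le> B * indicator (cball 0 (R + norm c)) z"
proof (cases "f (z - c) = 0")
  case True
  then show ?thesis using bound by (simp add: translate_def)
next
  case False
  then have "norm z \<le> R + norm c"
    using supp(2)[of "z - c"] norm_triangle_ineq2[of z c] by simp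
  then show ?thesis using bound by (simp add: translate_def)
qed

lemma translate_tendsto: "(\<lambda>j. translate f (c j) z) \<longlonglongrightarrow> translate f c' z" if "c \<longlonglongrightarrow> c'"
proof -
  have "isCont f (z - c')" using cont by (simp add: continuous_on_eq_continuous_at)
  then show ?thesis unfolding translate_def
    by (rule isCont_tendsto_compose) (intro tendsto_intros that)
qed

text \<open>\<open>K \<epsilon> c\<close> is the polar moment body of the translate of \<open>f\<close> by \<open>c\<close>, and, when \<open>K \<epsilon> c\<close> is compact, \<open>L \<epsilon> c\<close>
is the polar moment body of \<open>K \<epsilon> c\<close>. As a sublevel set \<open>L \<epsilon> c\<close> is defined for every \<open>c\<close>, so its centroid
is a vector field on the whole space.\<close>

definition K :: "real \<Rightarrow> 'a \<Rightarrow> 'a set" where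
  "K \<epsilon> c = moment_ball \<epsilon> p (translate f c)"

definition L :: "real \<Rightarrow> 'a \<Rightarrow> 'a set" where
  "L \<epsilon> c = moment_ball \<epsilon> p (indicator (K \<epsilon> c))"

context
  fixes \<epsilon> :: real
  assumes eps: "0 \<le> \<epsilon>" "\<epsilon> \<le> 1"
begin

lemma moment_int_translate_finite: "moment_int \<epsilon> p (translate f c) w < \<infinity>"
  by (rule moment_int_finite[OF eps p translate_le bound(1)])

text \<open>Moments of a bounded weight with bounded support are finite, so the bipolar identity applies.\<close>

lemma polar_moment_fun_eq: "polar_moment_fun \<epsilon> p (translate f c) = K \<epsilon> c"
proof -
  note facts = eps p translate_measurable translate_nonneg moment_int_translate_finite
  have "moment_body_fun \<epsilon> p (translate f c) = polar (moment_ball \<epsilon> p (translate f c))"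
    unfolding moment_body_fun_def
    by (rule convex_set_of_support_moment[OF facts, unfolded moment_int_def])
  then show ?thesis
    unfolding polar_moment_fun_def K_def by (simp only: polar_polar_moment_ball[OF facts])
qed

lemma closed_K: "closed (K \<epsilon> c)"
  unfolding K_def by (rule closed_moment_ball[OF eps p]) (auto simp: translate_nonneg)

lemma convex_K: "convex (K \<epsilon> c)"
  unfolding K_def by (rule convex_moment_ball[OF eps p]) (auto simp: translate_nonneg)

lemma K_measurable [measurable]: "K \<epsilon> c \<in> sets borel"
  by (simp add: borel_closed closed_K)

lemma closed_L: "closed (L \<epsilon> c)"
  unfolding L_def by (rule closed_moment_ball[OF eps p]) auto

lemma convex_L: "convex (L \<epsilon> c)"
  unfolding L_def by (rule convex_moment_ball[OF eps p]) auto

lemma L_measurable [measurable]: "L \<epsilon> c \<in> sets borel"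
  by (simp add: borel_closed closed_L)

lemma cball_subset_K:
  obtains r where "0 < r" "\<And>c. norm c \<le> \<rho> \<Longrightarrow> cball 0 r \<subseteq> K \<epsilon> c"
proof -
  have pos: "0 < R + \<bar>\<rho>\<bar>" using supp(1) by simp
  show ?thesis
  proof (rule small_cball_in_moment_ball[OF eps p bound(1) pos, where 'a='a], rule that)
    fix d :: real
    assume d: "0 < d" "\<And>m :: 'a \<Rightarrow> real. (\<And>z. m z \<le> B * indicator (cball 0 (R + \<bar>\<rho>\<bar>)) z) \<Longrightarrow> cball 0 d \<subseteq> moment_ball \<epsilon> p m"
    show "0 < d" by (rule d(1))
    fix c :: 'a assume c: "norm c \<le> \<rho>"
    show "cball 0 d \<subseteq> K \<epsilon> c"
      unfolding K_def
    proof (rule d(2))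
      fix z
      have "translate f c z \<le> B * indicator (cball 0 (R + norm c)) z" by (rule translate_le)
      also have "\<dots> \<le> B * indicator (cball 0 (R + \<bar>\<rho>\<bar>)) z"
        using c bound(1) by (intro mult_left_mono) (auto simp: indicator_def)
      finally show "translate f c z \<le> B * indicator (cball 0 (R + \<bar>\<rho>\<bar>)) z" .
    qed
  qed
qed

lemma compact_K:
  assumes "\<And>u. u \<noteq> 0 \<Longrightarrow> moment_int \<epsilon> p (translate f c) u \<noteq> 0"
  shows "compact (K \<epsilon> c)"
  unfolding compact_eq_bounded_closed
proof
  show "bounded (K \<epsilon> c)"
    unfolding K_def by (rule bounded_moment_ball[OF eps p translate_measurable translate_nonneg assms])
qed (rule closed_K)

lemma santalo_if_centred:
  assumes "compact (K \<epsilon> c)" and "(LINT z:L \<epsilon> c|lborel. z) = 0"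
  shows "is_santalo_point (moment_body_set \<epsilon> p (polar_moment_fun \<epsilon> p (translate f c))) 0 \<and>
    center_of_mass (polar_moment_set \<epsilon> p (polar_moment_fun \<epsilon> p (translate f c))) = 0"
proof -
  obtain r where r: "0 < r" "cball 0 r \<subseteq> K \<epsilon> c"
  proof (rule cball_subset_K)
    fix r assume r: "0 < r" "\<And>c'. norm c' \<le> norm c \<Longrightarrow> cball 0 r \<subseteq> K \<epsilon> c'"
    show thesis by (rule that[OF r(1) r(2)[OF order_refl]])
  qed
  have ball: "ball 0 r \<subseteq> K \<epsilon> c" by (rule subset_trans[OF ball_subset_cball r(2)])
  have 1: "is_santalo_point (moment_body_set \<epsilon> p (K \<epsilon> c)) 0"
   by (rule centred_moment_ball_santalo(1)[OF eps p assms(1) r(1) ball]) (rule assms(2)[unfolded L_def])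
   have 2: "center_of_mass (polar_moment_set \<epsilon> p (K \<epsilon> c)) = 0"
   by (rule centred_moment_ball_santalo(2)[OF eps p assms(1) r(1) ball]) (rule assms(2)[unfolded L_def])
  have eq: "polar_moment_fun \<epsilon> p (translate f c) = K \<epsilon> c" by (rule polar_moment_fun_eq)
  show ?thesis unfolding eq using 1 2 by (rule conjI)
qed

end

text \<open>For \<open>\<epsilon> = 1/2\<close> every body involved is symmetric about the origin, so the
origin is its centroid. Boundedness holds because \<open>f\<close> is not concentrated on a hyperplane.\<close>

lemma santalo_symmetric:
  "is_santalo_point (moment_body_set (1/2) p (polar_moment_fun (1/2) p (translate f 0))) 0 \<and>
    center_of_mass (polar_moment_set (1/2) p (polar_moment_fun (1/2) p (translate f 0))) = 0"
proof (rule santalo_if_centred[of "1/2"])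
  have "moment_int (1/2) p (translate f 0) u \<noteq> 0" if u: "u \<noteq> 0" for u
  proof
    assume "moment_int (1/2) p (translate f 0) u = 0"
    then have "AE z in lborel. translate f 0 z * asym_pow (1/2) p u z = 0"
      by (subst (asm) moment_int_eq_0_iff_AE) (auto simp: p translate_nonneg)
    with AE_lborel_not_orthogonal[OF u] have "AE z in lborel. f z = 0"
      by eventually_elim (auto simp: translate_def asym_pow_def max_def split: if_splits)
    moreover have "open {z. f z \<noteq> 0}"
      using open_Collect_neq[OF cont continuous_on_const[of UNIV "0::real"]] .
    ultimately obtain z where "z \<in> {z. f z \<noteq> 0}" "f z = 0"
      using nonzero by (elim AE_lborel_open_witness) auto
    then show False by simp
  qed
  then show "compact (K (1/2) 0)" by (intro compact_K) auto
  show "(LINT z:L (1/2) 0|lborel. z) = 0"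
  proof (rule set_integral_symmetric_eq_0)
    show "L (1/2) 0 \<in> sets borel" by (rule L_measurable) auto
    show "- z \<in> L (1/2) 0 \<longleftrightarrow> z \<in> L (1/2) 0" for z
      by (simp only: L_def moment_ball_def moment_int_half_minus mem_Collect_eq)
  qed
qed simp_all

text \<open>Passing from \<open>\<epsilon> = 0\<close> to \<open>\<epsilon> = 1\<close> reflects \<open>K\<close>, and the second moment operation undoes the reflection.\<close>

lemma L_1_eq: "L 1 c = L 0 c"
proof -
  have K: "indicator (K 1 c) = (\<lambda>z. indicator (K 0 c) (- z) :: real)"
    by (auto simp: K_def moment_ball_def moment_int_1 indicator_def fun_eq_iff)
  have "moment_int 1 p (indicator (K 1 c)) w = moment_int 0 p (indicator (K 0 c)) w" for w
    unfolding moment_int_1 K by (rule moment_int_reflect[OF p]) (use K_measurable[of 0] in auto)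
  then show ?thesis by (simp add: L_def moment_ball_def)
qed

lemma compact_K_1: "compact (K 0 c) \<Longrightarrow> compact (K 1 c)"
proof -
  assume "compact (K 0 c)"
  moreover have "K 1 c = uminus ` K 0 c"
  proof -
    have iff: "y \<in> K 1 c \<longleftrightarrow> - y \<in> K 0 c" for y by (simp add: K_def moment_ball_def moment_int_1)
    show ?thesis
    proof (rule set_eqI, rule iffI)
      fix y assume "y \<in> K 1 c"
      then have "- y \<in> K 0 c" by (simp only: iff)
      then show "y \<in> uminus ` K 0 c" by (rule rev_image_eqI) simp
    next
      fix y assume "y \<in> uminus ` K 0 c"
      then show "y \<in> K 1 c" by (elim imageE) (simp add: iff)
    qed
  qed
  ultimately show ?thesis by (simp add: compact_negations)
qed

end

section \<open>Dependence on the translation\<close>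

lemma AE_not_in_frontier:
  fixes S :: "'a::euclidean_space set"
  assumes "convex S"
  shows "AE y in lborel. y \<notin> frontier S"
proof (rule AE_I')
  have "frontier S \<in> sets borel" by (simp add: borel_closed)
  then show "frontier S \<in> null_sets lborel"
    using negligible_convex_frontier[OF assms]
    by (simp add: negligible_iff_null_sets null_sets_completion_iff)
qed auto

lemma indicator_tendsto_eventually:
  assumes "y \<in> S \<Longrightarrow> \<forall>\<^sub>F j in sequentially. y \<in> T j"
    and "y \<notin> S \<Longrightarrow> \<forall>\<^sub>F j in sequentially. y \<notin> T j"
  shows "(\<lambda>j. indicator (T j) y :: real) \<longlonglongrightarrow> indicator S y"
proof (cases "y \<in> S")
  case True
  then show ?thesis
    using assms(1) by (intro tendsto_eventually) (auto elim!: eventually_mono)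
next
  case False
  then show ?thesis
    using assms(2) by (intro tendsto_eventually) (auto elim!: eventually_mono)
qed

text \<open>The fixed point that Brouwer's theorem provides for the projection of \<open>c - V c\<close> to the ball; the
inequality is the characterisation of the nearest point.\<close>

lemma variational_inequality_cball:
  fixes V :: "'a::euclidean_space \<Rightarrow> 'a"
  assumes V: "continuous_on (cball 0 R) V" and R: "0 < R"
  obtains c where "c \<in> cball 0 R" "\<And>x. x \<in> cball 0 R \<Longrightarrow> V c \<bullet> (x - c) \<ge> 0"
proof -
  let ?C = "cball (0::'a) R"
  have ne: "?C \<noteq> {}" using R by auto
  obtain c where c: "c \<in> ?C" "closest_point ?C (c - V c) = c"
  proof (rule brouwer[of ?C "\<lambda>c. closest_point ?C (c - V c)"])
    have "continuous_on UNIV (closest_point ?C)" using ne by (intro continuous_on_closest_point) auto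
    then show "continuous_on ?C (\<lambda>c. closest_point ?C (c - V c))"
      by (rule continuous_on_compose2) (auto intro!: continuous_intros V)
    show "(\<lambda>c. closest_point ?C (c - V c)) \<in> ?C \<rightarrow> ?C"
    proof
      fix c show "closest_point ?C (c - V c) \<in> ?C" by (rule closest_point_in_set) (use ne in auto)
    qed
  qed (use ne in auto)
  show ?thesis
  proof (rule that[OF c(1)])
    fix x assume "x \<in> ?C"
    then have "(c - V c - closest_point ?C (c - V c)) \<bullet> (x - closest_point ?C (c - V c)) \<le> 0"
      by (intro closest_point_dot) auto
    then show "V c \<bullet> (x - c) \<ge> 0" unfolding c(2) by simp
  qed
qed

context compact_weight
begin

text \<open>The directions of vanishing moment are those that are nonpositive on the translated support; they
form the recession cone of \<open>K 0 c\<close>.\<close>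

lemma moment_int_0_eq_0_iff:
  "moment_int 0 p (translate f c) u = 0 \<longleftrightarrow> (\<forall>z. f z \<noteq> 0 \<longrightarrow> u \<bullet> (z + c) \<le> 0)"
proof
  assume "moment_int 0 p (translate f c) u = 0"
  then have ae: "AE z in lborel. translate f c z * asym_pow 0 p u z = 0"
    by (subst (asm) moment_int_eq_0_iff_AE) (auto simp: p translate_nonneg)
  let ?S = "{z. f (z - c) \<noteq> 0} \<inter> {z. u \<bullet> z > 0}"
  have "open {z. f (z - c) \<noteq> 0}"
    by (rule open_Collect_neq) (auto intro!: continuous_on_compose2[OF cont] continuous_intros)
  then have op: "open ?S" using open_halfspace_gt[of 0 u] by auto
  have "?S = {}"
  proof (rule ccontr)
    assume ne: "?S \<noteq> {}"
    obtain z where z: "z \<in> ?S" "translate f c z * asym_pow 0 p u z = 0"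
      by (rule AE_lborel_open_witness[OF ae op ne])
    then show False by (auto simp: translate_def asym_pow_0)
  qed
  then have *: "f (z - c) \<noteq> 0 \<Longrightarrow> u \<bullet> z \<le> 0" for z by (auto simp: not_less[symmetric])
  show "\<forall>z. f z \<noteq> 0 \<longrightarrow> u \<bullet> (z + c) \<le> 0" using *[of "z + c" for z] by auto
next
  assume *: "\<forall>z. f z \<noteq> 0 \<longrightarrow> u \<bullet> (z + c) \<le> 0"
  have "translate f c z * asym_pow 0 p u z = 0" for z
    using *[rule_format, of "z - c"] by (cases "f (z - c) = 0") (auto simp: translate_def asym_pow_0 max_def)
  then show "moment_int 0 p (translate f c) u = 0" unfolding moment_int_def by (simp only:) simp
qed

lemma K_add_recession:
  assumes u: "moment_int 0 p (translate f c) u = 0" and y: "y \<in> K 0 c" and t: "0 \<le> t"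
  shows "y + t *\<^sub>R u \<in> K 0 c"
proof -
  have "moment_int 0 p (translate f c) (y + t *\<^sub>R u) \<le> moment_int 0 p (translate f c) y"
  proof (rule moment_int_mono)
    fix z
    show "translate f c z * asym_pow 0 p (y + t *\<^sub>R u) z \<le> translate f c z * asym_pow 0 p y z"
    proof (cases "f (z - c) = 0")
      case False
      then have "u \<bullet> z \<le> 0" using u[unfolded moment_int_0_eq_0_iff, rule_format, of "z - c"] by simp
      then have "(y + t *\<^sub>R u) \<bullet> z \<le> y \<bullet> z" using t by (simp add: inner_add_left mult_nonneg_nonpos)
      then have "max ((y + t *\<^sub>R u) \<bullet> z) 0 powr p \<le> max (y \<bullet> z) 0 powr p"
        using p by (intro powr_mono2) auto
      then show ?thesis unfolding asym_pow_0 by (rule mult_left_mono) (rule translate_nonneg)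
    qed (simp add: translate_def)
  qed
  then show ?thesis using y unfolding K_def moment_ball_def by (auto intro: order_trans)
qed

text \<open>If \<open>u\<close> is a recession direction of \<open>K 0 c\<close> and \<open>w \<bullet> u > 0\<close>, then \<open>K 0 c\<close> contains the balls of a fixed
radius about all \<open>t *\<^sub>R u\<close>, on which \<open>w \<bullet> y\<close> grows without bound, so the moment in direction \<open>w\<close> is
infinite.\<close>

lemma L_subset_halfspace:
  assumes u: "moment_int 0 p (translate f c) u = 0" and w: "w \<in> L 0 c"
  shows "w \<bullet> u \<le> 0"
proof (rule ccontr)
  assume "\<not> w \<bullet> u \<le> 0"
  then have wu: "w \<bullet> u > 0" by simp
  obtain r where r: "0 < r" "cball 0 r \<subseteq> K 0 c"
  proof (rule cball_subset_K[of 0])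
    fix r assume r: "0 < r" "\<And>c'. norm c' \<le> norm c \<Longrightarrow> cball 0 r \<subseteq> K 0 c'"
    show thesis by (rule that[OF r(1) r(2)[OF order_refl]])
  qed simp_all
  define v where "v = unit_ball_vol (real DIM('a)) * r ^ DIM('a)"
  have v: "v > 0" using r by (simp add: v_def)
  \<comment> \<open>\<open>t\<close> is chosen so that \<open>w \<bullet> y \<ge> s\<close> on the ball, and then \<open>s powr p * v \<ge> s * v \<ge> 2\<close>.\<close>
  define s where "s = max 1 (2 / v)"
  define t where "t = (s + norm w * r) / (w \<bullet> u)"
  have s: "s \<ge> 1" "s \<ge> 2 / v" by (auto simp: s_def)
  have t: "t \<ge> 0" "t * (w \<bullet> u) = s + norm w * r" using wu s r by (auto simp: t_def)
  have "ennreal s * emeasure lborel (ball (t *\<^sub>R u) r) = (\<integral>\<^sup>+ y. ennreal s * indicator (ball (t *\<^sub>R u) r) y \<partial>lborel)"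
    by (rule nn_integral_cmult_indicator[symmetric]) simp
  also have "\<dots> \<le> moment_int 0 p (indicator (K 0 c)) w"
    unfolding moment_int_def
  proof (rule nn_integral_mono)
    fix y
    show "ennreal s * indicator (ball (t *\<^sub>R u) r) y \<le> ennreal (indicat_real (K 0 c) y * asym_pow 0 p w y)"
    proof (cases "y \<in> ball (t *\<^sub>R u) r")
      case True
      define x where "x = y - t *\<^sub>R u"
      have x: "norm x \<le> r" using True by (simp add: x_def dist_norm norm_minus_commute)
      have y: "y = x + t *\<^sub>R u" by (simp add: x_def)
      have "x \<in> K 0 c" using x r by auto
      then have "y \<in> K 0 c" unfolding y by (rule K_add_recession[OF u _ t(1)])
      have "- (norm w * r) \<le> w \<bullet> x"
      proof -
        have "\<bar>w \<bullet> x\<bar> \<le> norm w * norm x" by (rule Cauchy_Schwarz_ineq2)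
        also have "\<dots> \<le> norm w * r" using x by (intro mult_left_mono) auto
        finally show ?thesis by linarith
      qed
      then have "s \<le> w \<bullet> y" unfolding y using t(2) by (simp add: inner_add_right)
      moreover have "s \<le> s powr p" using powr_mono[of 1 p s] s p by simp
      moreover have "s powr p \<le> max (w \<bullet> y) 0 powr p"
        using s p \<open>s \<le> w \<bullet> y\<close> by (intro powr_mono2) auto
      ultimately have "s \<le> asym_pow 0 p w y"
        unfolding asym_pow_0 by linarith
      then show ?thesis using True \<open>y \<in> K 0 c\<close> by (simp add: ennreal_leI)
    qed simp
  qed
  also have "\<dots> \<le> 1" using w by (simp add: L_def moment_ball_def)
  finally have "ennreal s * emeasure lborel (ball (t *\<^sub>R u) r) \<le> 1" .
  then have "ennreal (s * v) \<le> 1"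
    using s v r by (simp add: emeasure_ball v_def[symmetric] ennreal_mult)
  then have "s * v \<le> 1" by (simp add: ennreal_le_1)
  moreover have "s * v \<ge> 2" using s(2) v by (simp add: divide_simps)
  ultimately show False by simp
qed

text \<open>Strict negativity of \<open>w\<close> on the recession cone of the limit cuts off a uniformly bounded part of the
nearby bodies. One natural number serves as index and as radius in the argument by contradiction.\<close>

lemma K_halfspace_eventually_bounded:
  assumes c: "c \<longlonglongrightarrow> c'"
    and w: "\<And>u. u \<noteq> 0 \<Longrightarrow> moment_int 0 p (translate f c') u = 0 \<Longrightarrow> w \<bullet> u < 0"
  obtains J \<rho> where "\<And>j y. J \<le> j \<Longrightarrow> y \<in> K 0 (c j) \<Longrightarrow> 0 \<le> w \<bullet> y \<Longrightarrow> norm y \<le> real \<rho>"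
proof -
  have "\<exists>n. \<forall>j\<ge>n. \<forall>y\<in>K 0 (c j). 0 \<le> w \<bullet> y \<longrightarrow> norm y \<le> real n"
  proof (rule ccontr)
    assume "\<not> ?thesis"
    then have "\<forall>n. \<exists>j y. n \<le> j \<and> y \<in> K 0 (c j) \<and> 0 \<le> w \<bullet> y \<and> real n < norm y"
      by (simp add: not_le) blast
    then obtain j y where jy: "\<And>n. n \<le> j n" "\<And>n. y n \<in> K 0 (c (j n))" "\<And>n. 0 \<le> w \<bullet> y n" "\<And>n. real n < norm (y n)"
      by metis
    have "filterlim j at_top sequentially" using jy(1)
      by (intro filterlim_at_top_mono[OF filterlim_ident]) auto
    then have cj: "(\<lambda>n. c (j n)) \<longlonglongrightarrow> c'" using c by (rule filterlim_compose[rotated])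
    have "\<exists>u r. norm u = 1 \<and> (\<lambda>n. y (r n) /\<^sub>R norm (y (r n))) \<longlonglongrightarrow> u \<and> moment_int 0 p (translate f c') u = 0"
    proof (rule moment_int_escape[of 0 p "\<lambda>n. translate f (c (j n))" "translate f c'" y])
      show "AE z in lborel. (\<lambda>n. translate f (c (j n)) z) \<longlonglongrightarrow> translate f c' z"
        by (intro AE_I2 translate_tendsto cj)
    qed (use jy p translate_nonneg in \<open>auto simp: K_def\<close>)
    then obtain u r where u: "norm u = 1" "moment_int 0 p (translate f c') u = 0"
      and lim: "(\<lambda>n. y (r n) /\<^sub>R norm (y (r n))) \<longlonglongrightarrow> u" by blast
    have "(\<lambda>n. w \<bullet> (y (r n) /\<^sub>R norm (y (r n)))) \<longlonglongrightarrow> w \<bullet> u" by (intro tendsto_intros lim)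
    then have "0 \<le> w \<bullet> u" by (rule LIMSEQ_le_const) (use jy(3) in \<open>auto intro!: exI[of _ 0]\<close>)
    moreover have "u \<noteq> 0" using u by auto
    ultimately show False using w[OF _ u(2)] by simp
  qed
  then show ?thesis using that by blast
qed

lemma indicator_K_tendsto:
  assumes c: "c \<longlonglongrightarrow> c'"
  shows "AE y in lborel. (\<lambda>j. indicator (K 0 (c j)) y :: real) \<longlonglongrightarrow> indicator (K 0 c') y"
proof -
  have lim: "(\<lambda>j. moment_int 0 p (translate f (c j)) y) \<longlonglongrightarrow> moment_int 0 p (translate f c') y" for y
  proof -
    obtain D where D: "\<And>j. norm (c j) \<le> D"
      using convergent_imp_Bseq[OF convergentI[OF c]] by (auto simp: Bseq_def)
    show ?thesis
    proof (rule moment_int_tendsto[where B = B and R = "R + D"])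
      show "translate f (c j) z \<le> B * indicator (cball 0 (R + D)) z" for j z
      proof -
        have "B * indicator (cball 0 (R + norm (c j))) z \<le> B * indicator (cball 0 (R + D)) z"
          using D[of j] bound(1) by (intro mult_left_mono) (auto simp: indicator_def)
        then show ?thesis using translate_le[of "c j" z] by linarith
      qed
    qed (auto simp: p translate_nonneg bound intro: translate_tendsto[OF c])
  qed
  have "AE y in lborel. y \<notin> frontier (K 0 c')" by (intro AE_not_in_frontier convex_K) auto
  then show ?thesis
  proof eventually_elim
    case (elim y)
    show ?case
    proof (rule indicator_tendsto_eventually)
      assume "y \<in> K 0 c'"
      then have "y \<in> interior (K 0 c')" using elim closure_subset by (auto simp: frontier_def)
      then have "moment_int 0 p (translate f c') y < 1"
        unfolding K_def by (intro moment_int_less_1_if_interior) (auto simp: p translate_nonneg)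
      from order_tendstoD(2)[OF lim this]
      show "\<forall>\<^sub>F j in sequentially. y \<in> K 0 (c j)"
        by eventually_elim (simp add: K_def moment_ball_def less_imp_le)
    next
      assume "y \<notin> K 0 c'"
      then have "1 < moment_int 0 p (translate f c') y" by (simp add: K_def moment_ball_def not_le)
      from order_tendstoD(1)[OF lim this]
      show "\<forall>\<^sub>F j in sequentially. y \<notin> K 0 (c j)"
        by eventually_elim (simp add: K_def moment_ball_def not_le)
    qed
  qed
qed

text \<open>Here the bodies may be unbounded, and Fatou points in the right direction.\<close>

lemma eventually_not_in_L:
  assumes c: "c \<longlonglongrightarrow> c'" and w: "w \<notin> L 0 c'"
  shows "\<forall>\<^sub>F j in sequentially. w \<notin> L 0 (c j)"
proof -
  have "1 < moment_int 0 p (indicator (K 0 c')) w" using w by (simp add: L_def moment_ball_def not_le)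
  also have "\<dots> \<le> liminf (\<lambda>j. moment_int 0 p (indicator (K 0 (c j))) w)"
    by (rule moment_int_fatou[where u = "\<lambda>_. w"]) (auto simp: p intro!: indicator_K_tendsto c K_measurable)
  finally have "\<forall>\<^sub>F j in sequentially. 1 < moment_int 0 p (indicator (K 0 (c j))) w"
    by (rule less_LiminfD)
  then show ?thesis by eventually_elim (simp add: L_def moment_ball_def not_le)
qed

lemma moment_int_indicator_Int_halfspace:
  "moment_int 0 p (indicator (S \<inter> {y. 0 \<le> w \<bullet> y})) w = moment_int 0 p (indicator S) w"
  unfolding moment_int_def asym_pow_0
  by (intro nn_integral_cong) (auto simp: indicator_def max_def)

text \<open>Interior points of \<open>L 0 c'\<close> are strictly negative on the recession cone, because \<open>L 0 c'\<close> lies in its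
polar cone. Hence only a bounded part of the bodies contributes to the moment in direction \<open>w\<close>, and
dominated convergence applies.\<close>

lemma eventually_in_L:
  assumes c: "c \<longlonglongrightarrow> c'" and w: "w \<in> interior (L 0 c')"
  shows "\<forall>\<^sub>F j in sequentially. w \<in> L 0 (c j)"
proof -
  have wu: "w \<bullet> u < 0" if u: "u \<noteq> 0" "moment_int 0 p (translate f c') u = 0" for u
  proof -
    obtain e where e: "e > 0" "ball w e \<subseteq> L 0 c'" using w by (auto simp: mem_interior)
    define d where "d = e / (2 * norm u)"
    have d: "d > 0" using e u by (simp add: d_def)
    \<comment> \<open>Moving from \<open>w\<close> a little in direction \<open>u\<close> stays in \<open>L 0 c'\<close>, which makes the inequality for \<open>w\<close> strict.\<close>
    have "w + d *\<^sub>R u \<in> ball w e" using e u by (simp add: dist_norm d_def)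
    then have "(w + d *\<^sub>R u) \<bullet> u \<le> 0" using e L_subset_halfspace[OF u(2)] by blast
    moreover have "d * (u \<bullet> u) > 0" using d u by simp
    ultimately show ?thesis by (simp add: inner_add_left)
  qed
  obtain J \<rho> where J: "\<And>j y. J \<le> j \<Longrightarrow> y \<in> K 0 (c j) \<Longrightarrow> 0 \<le> w \<bullet> y \<Longrightarrow> norm y \<le> real \<rho>"
    by (rule K_halfspace_eventually_bounded[OF c wu]) auto
  have cJ: "(\<lambda>j. c (j + J)) \<longlonglongrightarrow> c'" by (rule LIMSEQ_ignore_initial_segment[OF c])
  let ?H = "{y. 0 \<le> w \<bullet> y}"
  have H [measurable]: "?H \<in> sets borel"
    by (intro borel_closed closed_Collect_le continuous_intros)
  have "(\<lambda>j. moment_int 0 p (indicator (K 0 (c (j + J)) \<inter> ?H)) w) \<longlonglongrightarrow> moment_int 0 p (indicator (K 0 c' \<inter> ?H)) w"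
  proof (rule moment_int_tendsto[where B = 1 and R = "real \<rho>" and u = "\<lambda>_. w"])
    show "indicat_real (K 0 (c (j + J)) \<inter> ?H) y \<le> 1 * indicator (cball 0 (real \<rho>)) y" for j y
      using J[of "j + J" y] by (auto simp: indicator_def)
    show "AE y in lborel. (\<lambda>j. indicat_real (K 0 (c (j + J)) \<inter> ?H) y) \<longlonglongrightarrow> indicat_real (K 0 c' \<inter> ?H) y"
      using indicator_K_tendsto[OF cJ]
      by eventually_elim (auto simp: indicator_inter_arith intro!: tendsto_intros)
  qed (auto simp: p intro!: borel_measurable_indicator sets.Int H K_measurable)
  then have "(\<lambda>j. moment_int 0 p (indicator (K 0 (c (j + J)))) w) \<longlonglongrightarrow> moment_int 0 p (indicator (K 0 c')) w"
    unfolding moment_int_indicator_Int_halfspace .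
  moreover have "moment_int 0 p (indicator (K 0 c')) w < 1"
    using w unfolding L_def by (intro moment_int_less_1_if_interior) (auto simp: p intro!: K_measurable)
  ultimately have "\<forall>\<^sub>F j in sequentially. moment_int 0 p (indicator (K 0 (c (j + J)))) w < 1"
    by (rule order_tendstoD(2))
  then have "\<forall>\<^sub>F j in sequentially. w \<in> L 0 (c (j + J))"
    by eventually_elim (simp add: L_def moment_ball_def less_imp_le)
  then show ?thesis using eventually_sequentially_seg[of "\<lambda>j. w \<in> L 0 (c j)" J] by simp
qed

text \<open>For bounded \<open>c\<close> the sets \<open>K 0 c\<close> contain a common ball, and the moment ball of its indicator contains
all \<open>L 0 c\<close>.\<close>

lemma L_uniformly_bounded:
  obtains \<rho> where "\<And>c w. norm c \<le> R \<Longrightarrow> w \<in> L 0 c \<Longrightarrow> norm w \<le> \<rho>"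
proof (rule cball_subset_K[of 0 R])
  fix r assume r: "0 < r" "\<And>c'. norm c' \<le> R \<Longrightarrow> cball 0 r \<subseteq> K 0 c'"
  have "bounded (moment_ball 0 p (indicator (cball (0::'a) r)))"
    using p r(1) by (intro bounded_moment_ball moment_int_indicator_nonzero[where r = r])
      (auto intro!: borel_measurable_indicator borel_closed)
  then obtain \<rho> where \<rho>: "\<And>w. w \<in> moment_ball 0 p (indicator (cball (0::'a) r)) \<Longrightarrow> norm w \<le> \<rho>"
    by (auto simp: bounded_iff)
  show thesis
  proof (rule that)
    fix c w assume c: "norm c \<le> R" and w: "w \<in> L 0 c"
    have "moment_int 0 p (indicator (cball 0 r)) w \<le> moment_int 0 p (indicator (K 0 c)) w"
      using r(2)[OF c] by (intro moment_int_mono mult_right_mono asym_pow_0_nonneg) (auto simp: indicator_def)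
    then show "norm w \<le> \<rho>" using w by (intro \<rho>) (auto simp: L_def moment_ball_def)
  qed
qed simp_all

lemma L_integrable: "set_integrable lborel (L 0 c) (\<lambda>z. z)" if "norm c \<le> R"
proof -
  obtain \<rho> where \<rho>: "\<And>c w. norm c \<le> R \<Longrightarrow> w \<in> L 0 c \<Longrightarrow> norm w \<le> \<rho>" by (rule L_uniformly_bounded) auto
  have "compact (L 0 c)"
    unfolding compact_eq_bounded_closed bounded_iff using \<rho>[OF that] closed_L[of 0 c] by auto
  then show ?thesis by (intro borel_integrable_compact[unfolded set_integrable_def[symmetric]]) (auto intro: continuous_intros)
qed

text \<open>The two preceding convergence statements cover every point off the boundary of the limit, which is a
null set because the limit is convex.\<close>

lemma continuous_on_centroid: "continuous_on (cball 0 R) (\<lambda>c. LINT z:L 0 c|lborel. z)"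
  unfolding continuous_on_sequentially
proof (intro allI ballI impI, elim conjE)
  fix c :: "nat \<Rightarrow> 'a" and c' :: 'a
  assume cR: "\<forall>j. c j \<in> cball 0 R" and c'R: "c' \<in> cball 0 R" and c: "c \<longlonglongrightarrow> c'"
  obtain \<rho> where \<rho>: "\<And>c w. norm c \<le> R \<Longrightarrow> w \<in> L 0 c \<Longrightarrow> norm w \<le> \<rho>" by (rule L_uniformly_bounded) auto
  have LM [measurable]: "L 0 a \<in> sets borel" for a by (rule L_measurable) auto
  have "(\<lambda>j. LINT z|lborel. indicat_real (L 0 (c j)) z *\<^sub>R z) \<longlonglongrightarrow> (LINT z|lborel. indicat_real (L 0 c') z *\<^sub>R z)"
  proof (rule integral_dominated_convergence[where w = "\<lambda>z. \<rho> * indicator (cball 0 \<rho>) z"])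
    show "integrable lborel (\<lambda>z::'a. \<rho> * indicator (cball 0 \<rho>) z :: real)"
      using emeasure_lborel_cball_finite[of "0::'a" \<rho>] by (auto simp: less_top)
    show "AE z in lborel. (\<lambda>j. indicat_real (L 0 (c j)) z *\<^sub>R z) \<longlonglongrightarrow> indicat_real (L 0 c') z *\<^sub>R z"
    proof -
      have "AE z in lborel. z \<notin> frontier (L 0 c')" by (intro AE_not_in_frontier convex_L) auto
      then show ?thesis
      proof eventually_elim
        case (elim z)
        have "(\<lambda>j. indicat_real (L 0 (c j)) z) \<longlonglongrightarrow> indicat_real (L 0 c') z"
        proof (rule indicator_tendsto_eventually)
          assume "z \<in> L 0 c'"
          then have "z \<in> interior (L 0 c')" using elim closure_subset by (auto simp: frontier_def)
          then show "\<forall>\<^sub>F j in sequentially. z \<in> L 0 (c j)" by (rule eventually_in_L[OF c])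
        qed (rule eventually_not_in_L[OF c])
        then show ?case by (intro tendsto_intros)
      qed
    qed
    show "AE z in lborel. norm (indicat_real (L 0 (c j)) z *\<^sub>R z) \<le> \<rho> * indicator (cball 0 \<rho>) z" for j
      using \<rho>[of "c j"] cR by (intro AE_I2) (auto simp: indicator_def intro: order_trans[OF norm_ge_zero])
  qed measurable
  then show "((\<lambda>c. LINT z:L 0 c|lborel. z) \<circ> c) \<longlonglongrightarrow> (LINT z:L 0 c'|lborel. z)"
    by (simp add: set_lebesgue_integral_def o_def)
qed

end

section \<open>A translation with vanishing centroid\<close>

context compact_weight
begin

lemma centroid_inner:
  assumes "norm c \<le> R"
  shows "integrable lborel (\<lambda>z. indicat_real (L 0 c) z * (u \<bullet> z))"
    and "(LINT z|lborel. indicat_real (L 0 c) z * (u \<bullet> z)) = u \<bullet> (LINT z:L 0 c|lborel. z)"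
proof -
  have i: "integrable lborel (\<lambda>z. indicat_real (L 0 c) z *\<^sub>R z)"
    using L_integrable[OF assms] by (simp add: set_integrable_def)
  have eq: "(\<lambda>z. indicat_real (L 0 c) z * (u \<bullet> z)) = (\<lambda>z. u \<bullet> (indicat_real (L 0 c) z *\<^sub>R z))"
    by (simp add: fun_eq_iff)
  show "integrable lborel (\<lambda>z. indicat_real (L 0 c) z * (u \<bullet> z))"
    unfolding eq by (rule integrable_inner_right) (rule i)
  show "(LINT z|lborel. indicat_real (L 0 c) z * (u \<bullet> z)) = u \<bullet> (LINT z:L 0 c|lborel. z)"
    unfolding eq set_lebesgue_integral_def by (rule integral_inner_right) (rule i)
qed

text \<open>If \<open>w\<close> lies in the open set where the translated weight is positive, then \<open>w\<close> is strictly negative on the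
recession cone and has finite moment, so a positive multiple of \<open>w\<close> is in \<open>L 0 c\<close>. These multiples do
not fit into a hyperplane.\<close>

lemma interior_L_nonempty: "interior (L 0 c) \<noteq> {}"
proof
  assume "interior (L 0 c) = {}"
  then obtain a b where a: "a \<noteq> 0" and sub: "L 0 c \<subseteq> {x. a \<bullet> x = b}"
    using empty_interior_subset_hyperplane[OF convex_L[of 0 c]] by auto
  have "0 \<in> L 0 c" unfolding L_def by (rule zero_in_moment_ball) (auto simp: p)
  then have b: "b = 0" using sub by auto
  have op: "open {z. f z \<noteq> 0}"
    using open_Collect_neq[OF cont continuous_on_const[of UNIV "0::real"]] .
  obtain z where "z \<in> {z. f z \<noteq> 0}" using nonzero by auto
  then obtain r where r: "0 < r" "ball z r \<subseteq> {z. f z \<noteq> 0}"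
    by (rule openE[OF op])
  have hyper: "a \<bullet> w = 0" if w: "w \<in> ball (z + c) r" for w
  proof -
    have wu: "w \<bullet> u < 0" if u: "u \<noteq> 0" "moment_int 0 p (translate f c) u = 0" for u
    proof -
      obtain e where e: "e > 0" "ball w e \<subseteq> ball (z + c) r"
        by (rule openE[OF open_ball w])
      define d where "d = e / (2 * norm u)"
      have d: "d > 0" using e u by (simp add: d_def)
      have "w + d *\<^sub>R u \<in> ball w e" using e u by (simp add: dist_norm d_def)
      then have "w + d *\<^sub>R u \<in> ball (z + c) r" using e by blast
      then have "f (w + d *\<^sub>R u - c) \<noteq> 0" using r(2)
        by (auto simp: dist_norm diff_diff_eq2 diff_add_eq subset_iff)
      then have "u \<bullet> (w + d *\<^sub>R u) \<le> 0"
        using u(2)[unfolded moment_int_0_eq_0_iff, rule_format, of "w + d *\<^sub>R u - c"] by simp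
      moreover have "d * (u \<bullet> u) > 0" using d u by simp
      ultimately show ?thesis by (simp add: inner_add_right inner_commute)
    qed
    obtain J :: nat and \<rho> where J: "\<And>j y. J \<le> j \<Longrightarrow> y \<in> K 0 c \<Longrightarrow> 0 \<le> w \<bullet> y \<Longrightarrow> norm y \<le> real \<rho>"
      by (rule K_halfspace_eventually_bounded[OF tendsto_const[of c] wu]) auto
    have "moment_int 0 p (indicator (K 0 c \<inter> {y. 0 \<le> w \<bullet> y})) w < \<infinity>"
    proof (rule moment_int_finite[where B = 1 and R = "real \<rho>"])
      show "indicat_real (K 0 c \<inter> {y. 0 \<le> w \<bullet> y}) y \<le> 1 * indicator (cball 0 (real \<rho>)) y" for y
        using J[OF order_refl, of y] by (auto simp: indicator_def)
    qed (auto simp: p)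
    then have "moment_int 0 p (indicator (K 0 c)) w < \<infinity>"
      unfolding moment_int_indicator_Int_halfspace .
    then obtain q where q: "moment_int 0 p (indicator (K 0 c)) w = ennreal q" "0 \<le> q"
      by (cases "moment_int 0 p (indicator (K 0 c)) w") auto
    define t where "t = 1 / (q + 1)"
    have t: "0 < t" "t \<le> 1" using q by (auto simp: t_def)
    have "t powr p \<le> t powr 1" using t p by (intro powr_mono') auto
    then have "t powr p * q \<le> t * q" using t q by (intro mult_right_mono) auto
    also have "\<dots> \<le> 1" using q by (simp add: t_def divide_simps)
    finally have "ennreal (t powr p) * moment_int 0 p (indicator (K 0 c)) w \<le> 1"
      unfolding q by (simp add: ennreal_mult'[symmetric])
    moreover have "moment_int 0 p (indicator (K 0 c)) (t *\<^sub>R w)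
        = ennreal (t powr p) * moment_int 0 p (indicator (K 0 c)) w"
      using t by (intro moment_int_scale) (auto simp: p intro!: K_measurable)
    ultimately have "t *\<^sub>R w \<in> L 0 c" by (simp add: L_def moment_ball_def)
    then have "a \<bullet> (t *\<^sub>R w) = 0" using sub b by blast
    then show ?thesis using t by simp
  qed
  define w where "w = z + c + (r / (2 * norm a)) *\<^sub>R a"
  have "w \<in> ball (z + c) r" "z + c \<in> ball (z + c) r" using r a by (auto simp: w_def dist_norm)
  from this[THEN hyper] have "(r / (2 * norm a)) * (a \<bullet> a) = 0" by (simp add: w_def inner_add_right)
  then show False using a r by simp
qed

text \<open>At the point given by the variational inequality, a nonzero \<open>V c\<close> would be an inner normal of the ball
at \<open>c\<close>; since the ball contains \<open>- z\<close> for all \<open>z\<close> in the support, \<open>V c\<close> would be a recession direction of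
\<open>K 0 c\<close>, and then \<open>L 0 c\<close>, hence its centroid, would be on the nonpositive side of \<open>V c\<close>. Once the centroid is zero,
a recession direction \<open>u \<noteq> 0\<close> is excluded as well: \<open>L 0 c\<close> would lie in \<open>{z. u \<bullet> z \<le> 0}\<close> and have
nonempty interior.\<close>

lemma exists_centred:
  obtains c where "compact (K 0 c)" "(LINT z:L 0 c|lborel. z) = 0"
proof -
  define V where "V = (\<lambda>c. LINT z:L 0 c|lborel. z)"
  obtain c where c: "c \<in> cball 0 R" and vi: "\<And>x. x \<in> cball 0 R \<Longrightarrow> V c \<bullet> (x - c) \<ge> 0"
    using variational_inequality_cball[OF continuous_on_centroid supp(1)] unfolding V_def by blast
  have cR: "norm c \<le> R" using c by simp
  have V_le: "u \<bullet> V c \<le> 0" if "moment_int 0 p (translate f c) u = 0" for u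
  proof -
    have "indicat_real (L 0 c) z * (u \<bullet> z) \<le> 0" for z
      using L_subset_halfspace[OF that, of z] by (auto simp: indicator_def inner_commute)
    then have "(LINT z|lborel. indicat_real (L 0 c) z * (u \<bullet> z)) \<le> (LINT z|(lborel :: 'a measure). 0)"
      by (intro integral_mono centroid_inner cR) auto
    then show ?thesis using centroid_inner(2)[OF cR, of u] by (simp add: V_def)
  qed
  have "moment_int 0 p (translate f c) (V c) = 0"
    unfolding moment_int_0_eq_0_iff
  proof (intro allI impI)
    fix z assume "f z \<noteq> 0"
    then have "- z \<in> cball 0 R" using supp(2) by simp
    from vi[OF this] show "V c \<bullet> (z + c) \<le> 0" by (simp add: inner_diff_right inner_add_right)
  qed
  from V_le[OF this] have V0: "V c = 0" by (metis inner_eq_zero_iff inner_ge_zero order_antisym)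
  have "moment_int 0 p (translate f c) u \<noteq> 0" if u: "u \<noteq> 0" for u
  proof
    assume u0: "moment_int 0 p (translate f c) u = 0"
    have le: "indicat_real (L 0 c) z * (u \<bullet> z) \<le> 0" for z
      using L_subset_halfspace[OF u0, of z] by (auto simp: indicator_def inner_commute)
    have int: "integrable lborel (\<lambda>z. - (indicat_real (L 0 c) z * (u \<bullet> z)))"
      by (intro integrable_minus centroid_inner cR)
    have "(LINT z|lborel. - (indicat_real (L 0 c) z * (u \<bullet> z))) = 0"
      using centroid_inner(2)[OF cR, of u] V0 by (simp add: V_def)
    then have "AE z in lborel. - (indicat_real (L 0 c) z * (u \<bullet> z)) = 0"
      using le by (subst (asm) integral_nonneg_eq_0_iff_AE[OF int]) auto
    with AE_lborel_not_orthogonal[OF u] have ae: "AE z in lborel. z \<notin> L 0 c"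
      by eventually_elim (auto simp: indicator_def split: if_splits)
    obtain z where "z \<in> interior (L 0 c)" "z \<notin> L 0 c"
      by (rule AE_lborel_open_witness[OF ae open_interior interior_L_nonempty])
    then show False using interior_subset by blast
  qed
  then have "compact (K 0 c)" by (intro compact_K) auto
  then show ?thesis using that V0 unfolding V_def by blast
qed

end

theorem theorem2p2:
  fixes f :: "real ^ 'n \<Rightarrow> real" and p \<epsilon> :: real
  assumes "CARD('n) \<ge> 2"
    and "p \<ge> 1"
    and "\<epsilon> \<in> {0, 1/2, 1}"
    and "continuous_on UNIV f"
    and "\<And>x. f x \<ge> 0"
    and "\<exists>x. f x \<noteq> 0"
    and "compact (closure {x. f x \<noteq> 0})"
  shows "\<exists>c :: real ^ 'n.
    is_santalo_point (moment_body_set \<epsilon> p (polar_moment_fun \<epsilon> p (translate f c))) 0 \<and>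
    center_of_mass (polar_moment_set \<epsilon> p (polar_moment_fun \<epsilon> p (translate f c))) = 0"
proof -
  let ?S = "closure {x. f x \<noteq> 0}"
  obtain R where R: "0 < R" "\<forall>x\<in>?S. norm x \<le> R"
    using compact_imp_bounded[OF assms(7)] unfolding bounded_pos by blast
  have "compact (f ` ?S)"
    by (intro compact_continuous_image assms(7) continuous_on_subset[OF assms(4)]) simp
  then have bd: "bounded (f ` ?S)" by (rule compact_imp_bounded)
  obtain B where B: "0 < B" "\<forall>y\<in>f ` ?S. norm y \<le> B"
    using bd unfolding bounded_pos by blast
  have in_S: "x \<in> ?S" if "f x \<noteq> 0" for x
    using that closure_subset[of "{x. f x \<noteq> 0}"] by blast
  interpret compact_weight f p B R
  proof
    show "f x \<le> B" for x
    proof (cases "f x = 0")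
      case False
      from B(2)[rule_format, OF imageI[OF in_S[OF this]]] show ?thesis by simp
    qed (use B in simp)
    show "norm x \<le> R" if "f x \<noteq> 0" for x by (rule R(2)[rule_format, OF in_S[OF that]])
  qed (use assms R B in auto)
  obtain c where c: "compact (K 0 c)" "(LINT z:L 0 c|lborel. z) = 0"
    by (rule exists_centred)
  from assms(3) consider "\<epsilon> = 0" | "\<epsilon> = 1/2" | "\<epsilon> = 1" by blast
  then show ?thesis
  proof cases
    case 1
    show ?thesis unfolding 1 by (intro exI[of _ c] santalo_if_centred c) auto
  next
    case 2
    show ?thesis unfolding 2 by (rule exI[of _ 0]) (rule santalo_symmetric)
  next
    case 3
    show ?thesis unfolding 3
    proof (intro exI[of _ c] santalo_if_centred)
      show "compact (K 1 c)" by (rule compact_K_1[OF c(1)])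
      show "(LINT z:L 1 c|lborel. z) = 0" unfolding L_1_eq by (rule c(2))
    qed auto
  qed
qed

end
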